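(* Let $F$ be a field of characteristic zero and let $V$ be a two-dimensional connected braided vector space of diagonal type over $F$ with basis $x_1,x_2$ and braiding $C(x_i\otimes x_j)=p_{i,j}\,x_j\otimes x_i$, where $p_{1,1}=p_{2,2}=-1$ (connectedness here means $p_{1,2}p_{2,1}\neq 1$). Let $m=\operatorname{ord}(p_{1,2}p_{2,1})\in\{2,3,\dots\}\cup\{\infty\}$. Define the subset $P_2$ of the Nichols algebra $\mathfrak B(V)$ as follows. If $m<\infty$ and $(-p_{2,1})^{m}=(-p_{1,2})^{m}=-1$, let $$P_2=\{p_{2,1}^{k+1}(x_1x_2)^{k+1}-p_{1,2}^{k+1}(x_2x_1)^{k+1},\ x_2(x_1x_2)^{k},\ (x_1x_2)^{k}x_1 : 0\le k<m\}\setminus\{p_{2,1}^{m}(x_1x_2)^{m}-p_{1,2}^{m}(x_2x_1)^{m}\};$$ otherwise let $$P_2=\{p_{2,1}^{k+1}(x_1x_2)^{k+1}-p_{1,2}^{k+1}(x_2x_1)^{k+1},\ x_2(x_1x_2)^{k},\ (x_1x_2)^{k}x_1 : 0\le k<m\}$$ (where $0\le k<\infty$ means $k$ ranges over all nonnegative integers). Then $P_2$ is a basis of the Nichols L-bicharacter algebra $\mathfrak L(V)_L$. Furthermore, if $m<\infty$, then $\dim \mathfrak L(V)_L=3m-1$ when $(-p_{2,1})^{m}=(-p_{1,2})^{m}=-1$, and $\dim\mathfrak L(V)_L=3m$ otherwise.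
   Context: $\mathfrak B(V)$ denotes the Nichols algebra of $(V,C)$: the quotient of the tensor algebra $T(V)$ by the ideal $\bigoplus_{m\ge2}\ker S_m$ of kernels of the quantum symmetrizers. It is $\mathbb Z^2$-graded with $\deg x_i=e_i$. For homogeneous $u,v$ with $\deg u=a_1e_1+a_2e_2$, $\deg v=b_1e_1+b_2e_2$ put $p_{u,v}=\prod_{i,j}p_{i,j}^{a_ib_j}$. The L-bracket is $[u,v]_L=p_{v,u}uv-p_{u,v}vu$ for homogeneous $u,v$, extended bilinearly; it is a Lie bracket on $\mathfrak B(V)$ (the commutator of the associative product $u\circ v=p_{v,u}uv$). $\mathfrak L(V)_L$ is the Lie subalgebra of $(\mathfrak B(V),[\cdot,\cdot]_L)$ generated by $V$. $\operatorname{ord}(q)$ is the multiplicative order of $q\in F^*$ ($\infty$ if $q$ is not a root of unity). *)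

theory Defs
  imports Main "HOL-Library.Extended_Nat" "HOL-Combinatorics.Permutations"
begin

text \<open>Rank-two braided vector space of diagonal type with basis x_1, x_2 (letters 1, 2).
  The braiding matrix is p :: nat => nat => 'a, with C(x_i (x) x_j) = p i j x_j (x) x_i.
  Elements of the tensor algebra T(V) are finitely supported functions from words
  (lists over {1,2}) to the field; the word [i1,...,in] stands for x_i1 ... x_in.\<close>

type_synonym 'a tens = "nat list \<Rightarrow> 'a"

definition wrd :: "nat list \<Rightarrow> 'a::field tens" where
  "wrd w = (\<lambda>u. if u = w then 1 else 0)"

definition tadd :: "'a::field tens \<Rightarrow> 'a tens \<Rightarrow> 'a tens" where
  "tadd f g = (\<lambda>u. f u + g u)"

definition tsmult :: "'a::field \<Rightarrow> 'a tens \<Rightarrow> 'a tens" where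
  "tsmult c f = (\<lambda>u. c * f u)"

definition tdiff :: "'a::field tens \<Rightarrow> 'a tens \<Rightarrow> 'a tens" where
  "tdiff f g = (\<lambda>u. f u - g u)"

definition tlincomb :: "'i set \<Rightarrow> ('i \<Rightarrow> 'a::field) \<Rightarrow> ('i \<Rightarrow> 'a tens) \<Rightarrow> 'a tens" where
  "tlincomb J c f = (\<lambda>u. \<Sum>j\<in>J. c j * f j u)"

definition tmul :: "'a::field tens \<Rightarrow> 'a tens \<Rightarrow> 'a tens" where
  "tmul f g = (\<lambda>u. \<Sum>i\<le>length u. f (take i u) * g (drop i u))"

text \<open>The bicharacter p_{v,u} = \<Prod>_{i,j} p_{i,j}^{a_i b_j} for words v (degree a) and u (degree b).\<close>
definition chi :: "(nat \<Rightarrow> nat \<Rightarrow> 'a::field) \<Rightarrow> nat list \<Rightarrow> nat list \<Rightarrow> 'a" where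
  "chi p v u = (\<Prod>a<length v. \<Prod>b<length u. p (v ! a) (u ! b))"

text \<open>Quantum symmetrizer applied to a single word of length n:
  S_n(x_{i_1}...x_{i_n}) = \<Sum>_\<sigma> (\<Prod>_{a<b, \<sigma> a > \<sigma> b} p_{i_a,i_b}) x_{i_{\<sigma>^{-1}(1)}}...x_{i_{\<sigma>^{-1}(n)}}.\<close>
definition symw :: "(nat \<Rightarrow> nat \<Rightarrow> 'a::field) \<Rightarrow> nat list \<Rightarrow> 'a tens" where
  "symw p w = (\<lambda>u. \<Sum>\<sigma>\<in>{\<sigma>. \<sigma> permutes {..<length w}}.
      (if u = map (\<lambda>j. w ! inv \<sigma> j) [0..<length w]
       then (\<Prod>(a,b)\<in>{(a,b). a < b \<and> b < length w \<and> \<sigma> b < \<sigma> a}. p (w ! a) (w ! b))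
       else 0))"

definition symz :: "(nat \<Rightarrow> nat \<Rightarrow> 'a::field) \<Rightarrow> nat \<Rightarrow> 'a tens \<Rightarrow> 'a tens" where
  "symz p m f = (\<lambda>u. \<Sum>w\<in>{w. length w = m \<and> f w \<noteq> 0}. f w * symw p w u)"

text \<open>f lies in the ideal \<Oplus>_m ker S_m, i.e. f = 0 in the Nichols algebra B(V).
  (ker S_0 = ker S_1 = 0, so including m = 0, 1 is harmless.)\<close>
definition nichols_zero :: "(nat \<Rightarrow> nat \<Rightarrow> 'a::field) \<Rightarrow> 'a tens \<Rightarrow> bool" where
  "nichols_zero p f \<longleftrightarrow> (\<forall>m u. symz p m f u = 0)"

text \<open>The L-bracket [f,g]_L, bilinear extension of [u,v]_L = p_{v,u} uv - p_{u,v} vu on words.\<close>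
definition lbr :: "(nat \<Rightarrow> nat \<Rightarrow> 'a::field) \<Rightarrow> 'a tens \<Rightarrow> 'a tens \<Rightarrow> 'a tens" where
  "lbr p f g = (\<lambda>u. \<Sum>i\<le>length u. chi p (drop i u) (take i u) *
                      (f (take i u) * g (drop i u) - g (take i u) * f (drop i u)))"

text \<open>Lie subalgebra of (T(V), [,]_L) generated by V; its image in B(V) is L(V)_L.\<close>
inductive_set Lgen :: "(nat \<Rightarrow> nat \<Rightarrow> 'a::field) \<Rightarrow> 'a tens set" for p where
  gen1: "wrd [1] \<in> Lgen p"
| gen2: "wrd [2] \<in> Lgen p"
| add: "f \<in> Lgen p \<Longrightarrow> g \<in> Lgen p \<Longrightarrow> tadd f g \<in> Lgen p"
| smult: "f \<in> Lgen p \<Longrightarrow> tsmult c f \<in> Lgen p"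
| brk: "f \<in> Lgen p \<Longrightarrow> g \<in> Lgen p \<Longrightarrow> lbr p f g \<in> Lgen p"

definition is_basis_LV :: "(nat \<Rightarrow> nat \<Rightarrow> 'a::field) \<Rightarrow> 'i set \<Rightarrow> ('i \<Rightarrow> 'a tens) \<Rightarrow> bool" where
  "is_basis_LV p I b \<longleftrightarrow>
     (\<forall>i\<in>I. \<exists>l\<in>Lgen p. nichols_zero p (tdiff (b i) l)) \<and>
     (\<forall>J c. finite J \<longrightarrow> J \<subseteq> I \<longrightarrow> nichols_zero p (tlincomb J c b) \<longrightarrow> (\<forall>j\<in>J. c j = 0)) \<and>
     (\<forall>l\<in>Lgen p. \<exists>J c. finite J \<and> J \<subseteq> I \<and> nichols_zero p (tdiff l (tlincomb J c b)))"

definition LV_dim_eq :: "(nat \<Rightarrow> nat \<Rightarrow> 'a::field) \<Rightarrow> nat \<Rightarrow> bool" where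
  "LV_dim_eq p n \<longleftrightarrow> (\<exists>b. is_basis_LV p {..<n} b)"

definition mord :: "'a::field \<Rightarrow> enat" where
  "mord q = (if \<exists>n>0. q ^ n = 1 then enat (LEAST n. n > 0 \<and> q ^ n = 1) else \<infinity>)"

definition x12pow :: "nat \<Rightarrow> nat list" where
  "x12pow k = concat (replicate k [1, 2])"

definition x21pow :: "nat \<Rightarrow> nat list" where
  "x21pow k = concat (replicate k [2, 1])"

definition P2fam :: "(nat \<Rightarrow> nat \<Rightarrow> 'a::field) \<Rightarrow> nat \<times> nat \<Rightarrow> 'a tens" where
  "P2fam p tk = (case tk of (t, k) \<Rightarrow>
     if t = 0 then tdiff (tsmult (p 2 1 ^ (k+1)) (wrd (x12pow (k+1))))
                         (tsmult (p 1 2 ^ (k+1)) (wrd (x21pow (k+1))))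
     else if t = 1 then wrd (2 # x12pow k)
     else wrd (x12pow k @ [1]))"

definition exceptional :: "(nat \<Rightarrow> nat \<Rightarrow> 'a::field) \<Rightarrow> bool" where
  "exceptional p \<longleftrightarrow> (\<exists>n. mord (p 1 2 * p 2 1) = enat n \<and>
                         (- p 2 1) ^ n = -1 \<and> (- p 1 2) ^ n = -1)"

definition P2idx :: "(nat \<Rightarrow> nat \<Rightarrow> 'a::field) \<Rightarrow> (nat \<times> nat) set" where
  "P2idx p = {(t, k). t < 3 \<and> enat k < mord (p 1 2 * p 2 1)} -
             (if exceptional p then {(0, the_enat (mord (p 1 2 * p 2 1)) - 1)} else {})"

end

theory Submission
  imports Defs
begin

text \<open>
  Since \<open>p 1 1 = p 2 2 = -1\<close>, every word with a repeated adjacent letter is killed by the quantum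
  symmetrizer, so an element of the Nichols algebra is determined by its coefficients on alternating
  words. With \<open>q = p 1 2 * p 2 1\<close> and \<open>c\<^sub>k = (1 - q) \<cdots> (1 - q\<^sup>k)\<close>, skew derivations give that the
  symmetrizer multiplies an alternating word of length \<open>2k+1\<close> by \<open>c\<^sub>k\<close>, and sends \<open>(x\<^sub>1x\<^sub>2)\<^sup>k\<^sup>+\<^sup>1\<close> to
  \<open>c\<^sub>k ((x\<^sub>1x\<^sub>2)\<^sup>k\<^sup>+\<^sup>1 - (-p\<^sub>1\<^sub>2)\<^sup>k\<^sup>+\<^sup>1 (x\<^sub>2x\<^sub>1)\<^sup>k\<^sup>+\<^sup>1)\<close>. Hence everything vanishes once \<open>k \<ge> ord q\<close>.

  On the Lie side, in degree \<open>(k,k)\<close> all elements satisfy the linear relation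
  \<open>p\<^sub>1\<^sub>2\<^sup>k f((x\<^sub>1x\<^sub>2)\<^sup>k) + p\<^sub>2\<^sub>1\<^sup>k f((x\<^sub>2x\<^sub>1)\<^sup>k) = 0\<close>, because the L-bracket is antisymmetric. This bounds the Lie
  algebra from above; bracketing with \<open>[x\<^sub>1,x\<^sub>2]\<^sub>L\<close> raises the odd alternating words and yields all of
  \<open>P\<^sub>2\<close>. The exceptional case is the one where the degree \<open>(m,m)\<close> element lies in the kernel.
\<close>

declare One_nat_def [simp del]

section \<open>The quantum symmetrizer and skew derivations\<close>

text \<open>Summing over inverse permutations lets the output word be read off as
  \<open>w ! \<pi> j\<close>. The inversion (a,b) of the inverse corresponds to the inversion (inv
  \<open>\<pi>\<close> b, inv \<open>\<pi>\<close> a) of \<open>\<pi>\<close>.\<close>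

lemma symw_inverse:
  "symw p w u = (\<Sum>\<pi>\<in>{\<pi>. \<pi> permutes {..<length w}}.
      (if u = map (\<lambda>j. w ! \<pi> j) [0..<length w]
       then (\<Prod>(i,j)\<in>{(i,j). i < j \<and> j < length w \<and> \<pi> j < \<pi> i}. p (w ! \<pi> j) (w ! \<pi> i))
       else 0))"
proof -
  let ?n = "length w"
  have prod: "(\<Prod>(a,b)\<in>{(a,b). a < b \<and> b < ?n \<and> inv \<pi> b < inv \<pi> a}. p (w ! a) (w ! b))
     = (\<Prod>(i,j)\<in>{(i,j). i < j \<and> j < ?n \<and> \<pi> j < \<pi> i}. p (w ! \<pi> j) (w ! \<pi> i))"
    if "\<pi> permutes {..<?n}" for \<pi>
  proof (rule prod.reindex_bij_witness
      [where i = "\<lambda>(i,j). (\<pi> j, \<pi> i)" and j = "\<lambda>(a,b). (inv \<pi> b, inv \<pi> a)"])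
    have inv: "\<pi> (inv \<pi> x) = x" "inv \<pi> (\<pi> x) = x" for x
      using permutes_inverses[OF that] by auto
    have lt: "\<pi> x < ?n \<longleftrightarrow> x < ?n" "inv \<pi> x < ?n \<longleftrightarrow> x < ?n" for x
      using permutes_in_image[OF that] permutes_in_image[OF permutes_inv[OF that]] by auto
    fix x :: "nat \<times> nat"
    { assume "x \<in> {(a,b). a < b \<and> b < ?n \<and> inv \<pi> b < inv \<pi> a}"
      then show "(\<lambda>(i,j). (\<pi> j, \<pi> i)) ((\<lambda>(a,b). (inv \<pi> b, inv \<pi> a)) x) = x"
        and "(\<lambda>(a,b). (inv \<pi> b, inv \<pi> a)) x \<in> {(i,j). i < j \<and> j < ?n \<and> \<pi> j < \<pi> i}"
        and "(case (\<lambda>(a,b). (inv \<pi> b, inv \<pi> a)) x of (i,j) \<Rightarrow> p (w ! \<pi> j) (w ! \<pi> i))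
           = (case x of (a,b) \<Rightarrow> p (w ! a) (w ! b))"
        by (auto simp: inv lt) }
    { assume "x \<in> {(i,j). i < j \<and> j < ?n \<and> \<pi> j < \<pi> i}"
      then show "(\<lambda>(a,b). (inv \<pi> b, inv \<pi> a)) ((\<lambda>(i,j). (\<pi> j, \<pi> i)) x) = x"
        and "(\<lambda>(i,j). (\<pi> j, \<pi> i)) x \<in> {(a,b). a < b \<and> b < ?n \<and> inv \<pi> b < inv \<pi> a}"
        using lt(1)[of "fst x"] by (auto simp: inv lt) }
  qed
  show ?thesis
    unfolding symw_def
    apply (subst sum_permutations_inverse)
    apply (rule sum.cong[OF refl])
    apply (simp add: permutes_inv_inv prod cong: if_cong)
    done
qed

text \<open>The cycle sending \<open>n\<close> to \<open>a\<close> and shifting \<open>a\<close>,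
  ..., \<open>n - 1\<close> up by one. It lists the positions of a word of length
  \<open>Suc n\<close> with position \<open>a\<close> moved to the end; \<open>uncyc\<close> is its
  inverse.\<close>

definition cyc :: "nat \<Rightarrow> nat \<Rightarrow> nat \<Rightarrow> nat" where
  "cyc a n i = (if i < a \<or> n < i then i else if i < n then Suc i else a)"

definition uncyc :: "nat \<Rightarrow> nat \<Rightarrow> nat \<Rightarrow> nat" where
  "uncyc a n i = (if i < a \<or> n < i then i else if i = a then n else i - 1)"

lemma cyc_uncyc: "a \<le> n \<Longrightarrow> cyc a n (uncyc a n i) = i"
  and uncyc_cyc: "a \<le> n \<Longrightarrow> uncyc a n (cyc a n i) = i"
  by (auto simp: cyc_def uncyc_def)

lemma cyc_permutes: "a \<le> n \<Longrightarrow> cyc a n permutes {..<Suc n}"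
  by (rule bij_imp_permutes)
     (auto intro!: bij_betw_byWitness[where f' = "uncyc a n"] simp: cyc_uncyc uncyc_cyc,
      auto simp: cyc_def uncyc_def split: if_splits)

lemma uncyc_permutes: "a \<le> n \<Longrightarrow> uncyc a n permutes {..<Suc n}"
  by (rule bij_imp_permutes)
     (auto intro!: bij_betw_byWitness[where f' = "cyc a n"] simp: cyc_uncyc uncyc_cyc,
      auto simp: cyc_def uncyc_def split: if_splits)

text \<open>Coset decomposition: a permutation is determined by the image \<open>a\<close> of the
  last point together with a permutation fixing that point.\<close>

lemma sum_permutes_Suc:
  "(\<Sum>\<pi>\<in>{\<pi>. \<pi> permutes {..<Suc n}}. h \<pi>)
     = (\<Sum>a<Suc n. \<Sum>\<tau>\<in>{\<tau>. \<tau> permutes {..<n}}. h (cyc a n \<circ> \<tau>))"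
proof -
  have "(\<Sum>\<pi>\<in>{\<pi>. \<pi> permutes {..<Suc n}}. h \<pi>)
      = (\<Sum>(a,\<tau>)\<in>{..<Suc n} \<times> {\<tau>. \<tau> permutes {..<n}}. h (cyc a n \<circ> \<tau>))"
  proof (rule sum.reindex_bij_witness
      [where i = "\<lambda>(a,\<tau>). cyc a n \<circ> \<tau>" and j = "\<lambda>\<pi>. (\<pi> n, uncyc (\<pi> n) n \<circ> \<pi>)"])
    fix \<pi> :: "nat \<Rightarrow> nat"
    assume "\<pi> \<in> {\<pi>. \<pi> permutes {..<Suc n}}"
    then have perm: "\<pi> permutes {..<Suc n}" by simp
    then have le: "\<pi> n \<le> n" using permutes_in_image[OF perm, of n] by simp
    show eq: "(\<lambda>(a,\<tau>). cyc a n \<circ> \<tau>) (\<pi> n, uncyc (\<pi> n) n \<circ> \<pi>) = \<pi>"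
      using le by (auto simp: cyc_uncyc)
    have "uncyc (\<pi> n) n \<circ> \<pi> permutes {..<Suc n}"
      by (rule permutes_compose[OF perm uncyc_permutes[OF le]])
    then have "uncyc (\<pi> n) n \<circ> \<pi> permutes {..<n}"
      by (rule permutes_superset) (use le in \<open>auto simp: uncyc_def\<close>)
    then show "(\<pi> n, uncyc (\<pi> n) n \<circ> \<pi>) \<in> {..<Suc n} \<times> {\<tau>. \<tau> permutes {..<n}}"
      using le by auto
    show "(case (\<pi> n, uncyc (\<pi> n) n \<circ> \<pi>) of (a,\<tau>) \<Rightarrow> h (cyc a n \<circ> \<tau>)) = h \<pi>"
      using eq by simp
  next
    fix x :: "nat \<times> (nat \<Rightarrow> nat)"
    assume "x \<in> {..<Suc n} \<times> {\<tau>. \<tau> permutes {..<n}}"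
    then obtain a \<tau> where x: "x = (a,\<tau>)" and a: "a \<le> n" and t: "\<tau> permutes {..<n}" by auto
    have n: "\<tau> n = n" using t by (simp add: permutes_def)
    have cn: "cyc a n n = a" using a by (simp add: cyc_def)
    show "(((\<lambda>(a,\<tau>). cyc a n \<circ> \<tau>) x) n, uncyc (((\<lambda>(a,\<tau>). cyc a n \<circ> \<tau>) x) n) n \<circ> ((\<lambda>(a,\<tau>). cyc a n \<circ> \<tau>) x)) = x"
      using a by (auto simp: x n cn uncyc_cyc)
    have "\<tau> permutes {..<Suc n}" by (rule permutes_subset[OF t]) auto
    then show "(\<lambda>(a,\<tau>). cyc a n \<circ> \<tau>) x \<in> {\<pi>. \<pi> permutes {..<Suc n}}"
      using permutes_compose[OF _ cyc_permutes[OF a]] by (simp add: x)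
  qed
  then show ?thesis by (simp add: sum.cartesian_product)
qed

lemma cyc_less_iff: "i < n \<Longrightarrow> j < n \<Longrightarrow> cyc a n i < cyc a n j \<longleftrightarrow> i < j"
  by (auto simp: cyc_def)

lemma nth_delete:
  assumes "length w = Suc n" "a \<le> n" "i < n"
  shows "(take a w @ drop (Suc a) w) ! i = w ! cyc a n i"
  using assms by (auto simp: nth_append cyc_def min_def)

text \<open>Splitting a permutation of the word according to the letter that is moved to the end.\<close>
lemma symw_snoc_sum:
  assumes len: "length w = Suc n"
  shows "symw p w (u @ [y]) = (\<Sum>a<Suc n. if w ! a = y
      then (\<Prod>b\<in>{a<..n}. p (w ! a) (w ! b)) * symw p (take a w @ drop (Suc a) w) u else 0)"
proof -
  have "(if u @ [y] = map (\<lambda>j. w ! (cyc a n \<circ> \<tau>) j) [0..<Suc n]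
       then (\<Prod>(i,j)\<in>{(i,j). i < j \<and> j < Suc n \<and> (cyc a n \<circ> \<tau>) j < (cyc a n \<circ> \<tau>) i}.
               p (w ! (cyc a n \<circ> \<tau>) j) (w ! (cyc a n \<circ> \<tau>) i)) else 0)
     = (if w ! a = y then (\<Prod>b\<in>{a<..n}. p (w ! a) (w ! b)) *
         (if u = map (\<lambda>j. (take a w @ drop (Suc a) w) ! \<tau> j) [0..<n]
          then (\<Prod>(i,j)\<in>{(i,j). i < j \<and> j < n \<and> \<tau> j < \<tau> i}.
            p ((take a w @ drop (Suc a) w) ! \<tau> j) ((take a w @ drop (Suc a) w) ! \<tau> i)) else 0)
        else 0)" (is "(if ?c then ?P else 0) = ?rhs")
    if a: "a \<le> n" and t: "\<tau> permutes {..<n}" for a \<tau>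
  proof -
    let ?v = "take a w @ drop (Suc a) w"
    have tn: "\<tau> n = n" using t by (simp add: permutes_def)
    have cn: "cyc a n n = a" using a by (simp add: cyc_def)
    have lt: "\<tau> i < n \<longleftrightarrow> i < n" for i using permutes_in_image[OF t] by auto
    have v: "?v ! \<tau> i = w ! cyc a n (\<tau> i)" if "i < n" for i
      using nth_delete[OF len a] that lt by simp
    have c: "?c \<longleftrightarrow> w ! a = y \<and> u = map (\<lambda>j. ?v ! \<tau> j) [0..<n]"
      by (auto simp: tn cn v)
    \<comment> \<open>Since \<open>cyc a n\<close> is increasing below \<open>n\<close>, the
      inversions not involving \<open>n\<close> are those of \<open>\<tau>\<close>. The inversions
      ending at \<open>n\<close> record the letters that the moved letter jumps over.\<close>
    have set: "{(i,j). i < j \<and> j < Suc n \<and> (cyc a n \<circ> \<tau>) j < (cyc a n \<circ> \<tau>) i}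
      = {(i,j). i < j \<and> j < n \<and> \<tau> j < \<tau> i} \<union> (\<lambda>i. (i,n)) ` {i. i < n \<and> a < cyc a n (\<tau> i)}"
      (is "_ = ?A \<union> ?B")
      by (auto simp: less_Suc_eq tn cn cyc_less_iff lt)
    have finA: "finite ?A"
      by (rule finite_subset[of _ "{..<n} \<times> {..<n}"]) auto
    have "?P = (\<Prod>(i,j)\<in>?A. p (w ! (cyc a n \<circ> \<tau>) j) (w ! (cyc a n \<circ> \<tau>) i)) *
               (\<Prod>(i,j)\<in>?B. p (w ! (cyc a n \<circ> \<tau>) j) (w ! (cyc a n \<circ> \<tau>) i))"
      unfolding set by (rule prod.union_disjoint) (use finA in auto)
    also have "(\<Prod>(i,j)\<in>?A. p (w ! (cyc a n \<circ> \<tau>) j) (w ! (cyc a n \<circ> \<tau>) i))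
       = (\<Prod>(i,j)\<in>?A. p (?v ! \<tau> j) (?v ! \<tau> i))"
      by (rule prod.cong) (auto simp: v)
    also have "(\<Prod>(i,j)\<in>?B. p (w ! (cyc a n \<circ> \<tau>) j) (w ! (cyc a n \<circ> \<tau>) i))
       = (\<Prod>i\<in>{i. i < n \<and> a < cyc a n (\<tau> i)}. p (w ! a) (w ! cyc a n (\<tau> i)))"
      by (subst prod.reindex) (auto simp: inj_on_def tn cn)
    \<comment> \<open>As \<open>\<tau>\<close> only permutes the remaining positions, the letters
      jumped over are all those to the right of \<open>a\<close>, whatever \<open>\<tau>\<close>
      is.\<close>
    also have "\<dots> = (\<Prod>b\<in>{a<..n}. p (w ! a) (w ! b))"
    proof (rule prod.reindex_bij_witness
        [where i = "\<lambda>b. inv \<tau> (uncyc a n b)" and j = "\<lambda>i. cyc a n (\<tau> i)"])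
      have inv: "\<tau> (inv \<tau> x) = x" "inv \<tau> (\<tau> x) = x" for x
        using permutes_inverses[OF t] by auto
      have lti: "inv \<tau> x < n \<longleftrightarrow> x < n" for x
        using permutes_in_image[OF permutes_inv[OF t]] by auto
      { fix i assume "i \<in> {i. i < n \<and> a < cyc a n (\<tau> i)}"
        then show "inv \<tau> (uncyc a n (cyc a n (\<tau> i))) = i" "cyc a n (\<tau> i) \<in> {a<..n}"
          using a lt[of i] by (auto simp: uncyc_cyc inv) (auto simp: cyc_def split: if_splits) }
      { fix b assume "b \<in> {a<..n}"
        then show "cyc a n (\<tau> (inv \<tau> (uncyc a n b))) = b"
          "inv \<tau> (uncyc a n b) \<in> {i. i < n \<and> a < cyc a n (\<tau> i)}"
          using a by (auto simp: cyc_uncyc inv lti) (auto simp: uncyc_def) }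
    qed simp
    finally show ?thesis by (simp only: c) auto
  qed
  then have "symw p w (u @ [y]) = (\<Sum>a<Suc n. \<Sum>\<tau>\<in>{\<tau>. \<tau> permutes {..<n}}.
      if w ! a = y then (\<Prod>b\<in>{a<..n}. p (w ! a) (w ! b)) *
         (if u = map (\<lambda>j. (take a w @ drop (Suc a) w) ! \<tau> j) [0..<n]
          then (\<Prod>(i,j)\<in>{(i,j). i < j \<and> j < n \<and> \<tau> j < \<tau> i}.
            p ((take a w @ drop (Suc a) w) ! \<tau> j) ((take a w @ drop (Suc a) w) ! \<tau> i)) else 0)
        else 0)"
    unfolding symw_inverse[of p w] len sum_permutes_Suc
    by (intro sum.cong refl) (metis (no_types, lifting) less_Suc_eq_le lessThan_iff mem_Collect_eq)
  also have "\<dots> = (\<Sum>a<Suc n. if w ! a = y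
      then (\<Prod>b\<in>{a<..n}. p (w ! a) (w ! b)) * symw p (take a w @ drop (Suc a) w) u else 0)"
  proof (intro sum.cong refl)
    fix a assume "a \<in> {..<Suc n}"
    then have lenv: "length (take a w @ drop (Suc a) w) = n" using len by simp
    show "(\<Sum>\<tau>\<in>{\<tau>. \<tau> permutes {..<n}}.
      if w ! a = y then (\<Prod>b\<in>{a<..n}. p (w ! a) (w ! b)) *
         (if u = map (\<lambda>j. (take a w @ drop (Suc a) w) ! \<tau> j) [0..<n]
          then (\<Prod>(i,j)\<in>{(i,j). i < j \<and> j < n \<and> \<tau> j < \<tau> i}.
            p ((take a w @ drop (Suc a) w) ! \<tau> j) ((take a w @ drop (Suc a) w) ! \<tau> i)) else 0)
        else 0) = (if w ! a = y
      then (\<Prod>b\<in>{a<..n}. p (w ! a) (w ! b)) * symw p (take a w @ drop (Suc a) w) u else 0)"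
      unfolding symw_inverse[of p "take a w @ drop (Suc a) w"] lenv
      by (simp add: sum_distrib_left)
  qed
  finally show ?thesis .
qed

lemma symw_length: "length u \<noteq> length w \<Longrightarrow> symw p w u = 0"
  unfolding symw_def by (rule sum.neutral) auto

lemma symw_Nil: "symw p [] u = wrd [] u"
  by (simp add: symw_def wrd_def)

text \<open>The functional \<open>h\<close> applied to the skew derivative with respect to the letter \<open>y\<close> of a word,
  where deleting \<open>y\<close> costs the factor \<open>p y z\<close> for every letter \<open>z\<close> to its right.\<close>
fun dd :: "(nat \<Rightarrow> nat \<Rightarrow> 'a::field) \<Rightarrow> nat \<Rightarrow> (nat list \<Rightarrow> 'a) \<Rightarrow> nat list \<Rightarrow> 'a" where
  "dd p y h [] = 0"
| "dd p y h (x # w) = (if x = y then prod_list (map (p y) w) * h w else 0) + dd p y (\<lambda>v. h (x # v)) w"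

text \<open>Position-indexed form of the recursion, matching the sum in
  \<open>symw_snoc_sum\<close>. The functional changes along the recursion, so the induction
  generalizes over \<open>h\<close>.\<close>

lemma dd_eq_sum:
  "dd p y h w = (\<Sum>a<length w. if w ! a = y
      then (\<Prod>b\<in>{a<..<length w}. p (w ! a) (w ! b)) * h (take a w @ drop (Suc a) w) else 0)"
proof (induction w arbitrary: h)
  case (Cons x w)
  have shift: "(\<Prod>b\<in>{Suc a<..<Suc n}. g b) = (\<Prod>b\<in>{a<..<n}. g (Suc b))" for g :: "nat \<Rightarrow> 'a" and a n
    by (rule prod.reindex_bij_witness[of _ Suc "\<lambda>b. b - 1"]) auto
  have first: "(\<Prod>b\<in>{0<..<Suc (length w)}. p z (w ! (b - 1))) = prod_list (map (p z) w)" for z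
  proof -
    have "(\<Prod>b\<in>{0<..<Suc (length w)}. p z (w ! (b - 1))) = (\<Prod>b\<in>{0..<length w}. p z (w ! b))"
      by (rule prod.reindex_bij_witness[of _ Suc "\<lambda>b. b - 1"]) auto
    also have "\<dots> = prod_list (map (p z) w)" by (simp add: prod.list_conv_set_nth)
    finally show ?thesis .
  qed
  show ?case
    unfolding dd.simps length_Cons sum.lessThan_Suc_shift Cons.IH
    by (simp add: first shift cong: if_cong del: sum.lessThan_Suc)
qed simp

text \<open>A coefficient ending in \<open>y\<close> arises by choosing which occurrence of
  \<open>y\<close> is moved to the end and symmetrizing the rest. Later computations of
  \<open>symw\<close> rest on this recursion on the output word.\<close>

lemma symw_snoc: "symw p w (u @ [y]) = dd p y (\<lambda>v. symw p v u) w"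
proof (cases w)
  case Nil
  then show ?thesis by (simp add: symw_length)
next
  case (Cons x v)
  then have "length w = Suc (length v)" by simp
  moreover have "{a<..length v} = {a<..<length w}" for a using Cons by auto
  ultimately show ?thesis by (simp add: symw_snoc_sum dd_eq_sum cong: if_cong)
qed

lemma dd_zero [simp]: "dd p y (\<lambda>v. 0) w = 0"
  by (induction w) auto

text \<open>Skew Leibniz rule: a letter deleted from \<open>v\<close> has to pass all of
  \<open>w\<close> as well.\<close>

lemma dd_append:
  "dd p y h (v @ w) = prod_list (map (p y) w) * dd p y (\<lambda>t. h (t @ w)) v + dd p y (\<lambda>t. h (v @ t)) w"
  by (induction v arbitrary: h) (auto simp: algebra_simps)

text \<open>Deleting a letter outside the square leaves the square in place. Deleting either
  \<open>x\<close> of the square leaves the same word, and the two factors differ by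
  \<open>p x x = -1\<close>, so these contributions cancel.\<close>

lemma symw_square:
  assumes "p x x = -1"
  shows "symw p (v @ x # x # w) u = 0"
proof (induction u arbitrary: v w rule: rev_induct)
  case Nil
  then show ?case by (simp add: symw_length)
next
  case (snoc y u)
  have "symw p ((v @ [x, x]) @ t) u = 0" "symw p (v @ x # x # t) u = 0" for t v
    using snoc[of v t] by simp_all
  then show ?case using assms by (auto simp: symw_snoc dd_append)
qed

section \<open>Alternating words\<close>

definition oth :: "nat \<Rightarrow> nat" where
  "oth x = (if x = 1 then 2 else 1)"

lemma oth_simps [simp]: "oth 1 = 2" "oth 2 = 1"
  by (auto simp: oth_def)

primrec altw :: "nat \<Rightarrow> nat \<Rightarrow> nat list" where
  "altw x 0 = []"
| "altw x (Suc n) = x # altw (oth x) n"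

lemma length_altw [simp]: "length (altw x n) = n"
  by (induction n arbitrary: x) auto

lemma Nil_eq_altw_iff [simp]: "[] = altw x n \<longleftrightarrow> n = 0"
  by (cases n) auto

lemma set_altw: "x \<in> {1,2} \<Longrightarrow> set (altw x n) \<subseteq> {1,2}"
  by (induction n arbitrary: x) fastforce+

lemma letter_flip: "x \<in> {1,2} \<Longrightarrow> oth x \<in> {1,2::nat} \<and> oth (oth x) = x \<and> oth x \<noteq> x"
  by (auto simp: oth_def)

lemma take_altw: "i \<le> n \<Longrightarrow> take i (altw x n) = altw x i"
proof (induction n arbitrary: x i)
  case (Suc n)
  then show ?case by (cases i) auto
qed simp

lemma drop_altw: "x \<in> {1,2} \<Longrightarrow> drop i (altw x n) = altw (if even i then x else oth x) (n - i)"
proof (induction n arbitrary: x i)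
  case (Suc n)
  then show ?case using letter_flip[OF Suc.prems] by (cases i) auto
qed simp

lemma altw_append:
  assumes "x \<in> {1,2}"
  shows "altw x m @ altw (if even m then x else oth x) n = altw x (m + n)"
  using take_altw[of m "m + n" x] drop_altw[OF assms, of m "m + n"]
  by (metis append_take_drop_id diff_add_inverse le_add1)

lemma altw_eq_iff: "altw x m = altw y n \<longleftrightarrow> m = n \<and> (x = y \<or> n = 0)"
proof
  assume eq: "altw x m = altw y n"
  then have "m = n" by (metis length_altw)
  then show "m = n \<and> (x = y \<or> n = 0)" using eq by (cases n) auto
qed auto

lemma x12pow_eq: "x12pow k = altw 1 (2 * k)" and x21pow_eq: "x21pow k = altw 2 (2 * k)"
  by (induction k) (auto simp: x12pow_def x21pow_def)

text \<open>The dichotomy behind \<open>symz_eq\<close>: words with a square are killed, so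
  alternating words are all that remains.\<close>

lemma word_cases:
  assumes "set w \<subseteq> {1,2}"
  obtains x where "x \<in> {1,2}" "w = altw x (length w)"
  | x u v where "x \<in> {1,2}" "w = u @ x # x # v"
proof -
  have "(\<exists>x\<in>{1,2}. w = altw x (length w)) \<or> (\<exists>x u v. x \<in> {1,2} \<and> w = u @ x # x # v)"
    using assms
  proof (induction w)
    case (Cons y w)
    then have y: "y \<in> {1,2}" by simp
    from Cons consider x where "x \<in> {1,2}" "w = altw x (length w)"
      | x u v where "x \<in> {1,2}" "w = u @ x # x # v" by auto
    then show ?case
    proof cases
      case 1
      show ?thesis
      proof (cases w)
        case Nil
        then show ?thesis using y by auto
      next
        case (Cons z t)
        then have z: "z = x" using 1 by (metis altw.simps(2) length_Cons list.inject)
        show ?thesis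
        proof (cases "x = y")
          case True
          then have "y # w = [] @ y # y # t" using Cons z by simp
          then show ?thesis using y by blast
        next
          case False
          then have "x = oth y" using 1 y by auto
          then have "y # w = altw y (length (y # w))" using 1 by simp
          then show ?thesis using y by blast
        qed
      qed
    next
      case 2
      then have "y # w = (y # u) @ x # x # v" by simp
      then show ?thesis using 2 by blast
    qed
  qed auto
  then show ?thesis using that by blast
qed

text \<open>Behind the fixed prefix \<open>u @ [x]\<close>, deleting any letter but the last makes
  two equal letters adjacent, where \<open>h\<close> vanishes. The last letter has nothing to its
  right, so its factor is 1.\<close>

lemma dd_altw_Suc:
  assumes "x \<in> {1,2}" and "\<And>x u v. x \<in> {1,2} \<Longrightarrow> h (u @ x # x # v) = 0"
  shows "dd p y (\<lambda>v. h (u @ x # v)) (altw (oth x) (Suc n))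
    = (if y = (if even n then oth x else x) then h (u @ x # altw (oth x) n) else 0)"
  using assms(1)
proof (induction n arbitrary: x u)
  case (Suc n)
  note fl = letter_flip[OF Suc.prems]
  have "dd p y (\<lambda>v. h ((u @ [x]) @ (oth x) # v)) (altw (oth (oth x)) (Suc n))
    = (if y = (if even n then oth (oth x) else oth x)
       then h ((u @ [x]) @ (oth x) # altw (oth (oth x)) n) else 0)"
    by (rule Suc.IH) (use fl in auto)
  then show ?case using fl assms(2)[OF Suc.prems, of u] by simp
qed simp

text \<open>Deleting an inner letter of an alternating word creates a square,
  so only the two outer letters contribute.\<close>
lemma dd_altw:
  assumes x: "x \<in> {1,2}" and h: "\<And>x u v. x \<in> {1,2} \<Longrightarrow> h (u @ x # x # v) = 0"
  shows "dd p y h (altw x (Suc (Suc n)))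
    = (if y = x then prod_list (map (p x) (altw (oth x) (Suc n))) * h (altw (oth x) (Suc n)) else 0)
    + (if y = (if even n then oth x else x) then h (altw x (Suc n)) else 0)"
  using dd_altw_Suc[of x h p y "[]" n, OF x h] by simp

section \<open>The Nichols algebra\<close>

locale super_plane =
  fixes p :: "nat \<Rightarrow> nat \<Rightarrow> 'a::field_char_0"
  assumes p11: "p 1 1 = -1" and p22: "p 2 2 = -1"
    and p12: "p 1 2 \<noteq> 0" and p21: "p 2 1 \<noteq> 0"
begin

definition q :: 'a where "q = p 1 2 * p 2 1"

text \<open>The q-Pochhammer symbol (q;q)_k.\<close>

definition qpoch :: "nat \<Rightarrow> 'a" where "qpoch k = (\<Prod>i<k. 1 - q ^ Suc i)"

lemma pxx: "x \<in> {1,2} \<Longrightarrow> p x x = -1"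
  using p11 p22 by auto

lemma symw_letter_square: "x \<in> {1,2} \<Longrightarrow> symw p (u @ x # x # v) t = 0"
  by (rule symw_square) (rule pxx)

text \<open>The cost of moving the leading letter \<open>x\<close> past the rest of an alternating
  word: each pair of letters contributes \<open>p x (oth x)\<close> times
  \<open>p x x = -1\<close>.\<close>

lemma prod_altw:
  assumes x: "x \<in> {1,2}"
  shows "prod_list (map (p x) (altw (oth x) (2 * k))) = (- p x (oth x)) ^ k" (is ?e)
    and "prod_list (map (p x) (altw (oth x) (Suc (2 * k)))) = - ((- p x (oth x)) ^ Suc k)"
proof -
  show e: ?e
    using letter_flip[OF x] pxx[OF x] by (induction k) auto
  have "altw (oth x) (Suc (2 * k)) = altw (oth x) (2 * k) @ [oth x]"
    using altw_append[of "oth x" "2 * k" "Suc 0"] letter_flip[OF x] by simp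
  then show "prod_list (map (p x) (altw (oth x) (Suc (2 * k)))) = - ((- p x (oth x)) ^ Suc k)"
    using e by simp
qed

lemma symw_altw_Suc:
  assumes "x \<in> {1,2}"
  shows "symw p (altw x (Suc (Suc n))) (u @ [y])
    = (if y = x then prod_list (map (p x) (altw (oth x) (Suc n))) * symw p (altw (oth x) (Suc n)) u else 0)
    + (if y = (if even n then oth x else x) then symw p (altw x (Suc n)) u else 0)"
  unfolding symw_snoc by (rule dd_altw) (use assms symw_letter_square in auto)

lemma altw_snoc:
  assumes "x \<in> {1,2}"
  shows "altw x (Suc n) = altw x n @ [if even n then x else oth x]"
  using altw_append[OF assms, of n "Suc 0"] by simp

text \<open>Simultaneous induction over both parities, peeling off the last output letter. An odd
  word has equal outer letters, so both deletions contribute to the same coefficient; an even word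
  has different outer letters, each giving one of the two terms.\<close>

lemma symw_altw:
  assumes "x \<in> {1,2}"
  shows "symw p (altw x (Suc (2 * k))) u = qpoch k * wrd (altw x (Suc (2 * k))) u"
    and "symw p (altw x (2 * Suc k)) u = qpoch k * (wrd (altw x (2 * Suc k)) u
           - (- p x (oth x)) ^ Suc k * wrd (altw (oth x) (2 * Suc k)) u)"
  using assms
proof (induction k arbitrary: x u)
  case 0
  { case 1
    show ?case
      by (cases u rule: rev_cases)
         (auto simp: symw_length symw_snoc qpoch_def wrd_def symw_Nil)
  next
    case 2
    note fl = letter_flip[OF 2]
    have odd: "symw p [z] u = wrd [z] u" if "z \<in> {1,2}" for z u
      by (cases u rule: rev_cases) (auto simp: symw_length symw_snoc wrd_def symw_Nil)
    show ?case
    proof (cases u rule: rev_cases)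
      case Nil
      then show ?thesis by (auto simp: symw_length wrd_def)
    next
      case (snoc v y)
      show ?thesis
        unfolding snoc using symw_altw_Suc[OF 2, of 0 v y] fl 2
        by (auto simp: odd qpoch_def wrd_def numeral_2_eq_2)
    qed }
next
  case (Suc k)
  have odd: "symw p (altw z (Suc (2 * Suc k))) u = qpoch (Suc k) * wrd (altw z (Suc (2 * Suc k))) u"
    if z: "z \<in> {1,2}" for z u
  proof (cases u rule: rev_cases)
    case Nil
    then show ?thesis by (simp add: symw_length wrd_def)
  next
    case (snoc v y)
    note fl = letter_flip[OF z]
    have z': "oth z \<in> {1,2}" using fl by simp
    have sn: "wrd (altw z (Suc (2 * Suc k))) (v @ [y])
        = (if y = z then wrd (altw z (2 * Suc k)) v else (0::'a))"
      unfolding altw_snoc[OF z, of "2 * Suc k"] by (auto simp: wrd_def)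
    \<comment> \<open>In the sum of the two deletions the terms at the other even word cancel, and
      this product turns the remaining factor into 1 - q^(k+1), the new factor of
      \<open>qpoch (Suc k)\<close>.\<close>
    have q: "(- p z (oth z)) ^ Suc k * (- p (oth z) z) ^ Suc k = q ^ Suc k"
      unfolding power_mult_distrib[symmetric] using z by (auto simp: q_def mult_ac)
    have eq: "symw p (altw z (Suc (2 * Suc k))) (v @ [y])
      = (if y = z then (- p z (oth z)) ^ Suc k * symw p (altw (oth z) (2 * Suc k)) v
           + symw p (altw z (2 * Suc k)) v else 0)"
      using symw_altw_Suc[OF z, of "Suc (2 * k)" v y] prod_altw(1)[OF z, of "Suc k"] fl
      by (simp only: mult_Suc_right add_2_eq_Suc) auto
    show ?thesis
      unfolding snoc eq sn Suc.IH(2)[OF z] Suc.IH(2)[OF z']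
      using fl q by (auto simp: qpoch_def algebra_simps simp del: power_Suc)
  qed
  { case 1
    then show ?case by (rule odd)
  next
    case 2
    note fl = letter_flip[OF 2]
    have z': "oth x \<in> {1,2}" using fl by simp
    show ?case
    proof (cases u rule: rev_cases)
      case Nil
      then show ?thesis by (simp add: symw_length wrd_def)
    next
      case (snoc v y)
      have sn: "wrd (altw z (2 * Suc (Suc k))) (v @ [y])
          = (if y = oth z then wrd (altw z (Suc (2 * Suc k))) v else (0::'a))" if "z \<in> {1,2}" for z
        using altw_snoc[OF that, of "Suc (2 * Suc k)"] by (auto simp: wrd_def)
      have eq: "symw p (altw x (2 * Suc (Suc k))) (v @ [y])
        = (if y = x then - ((- p x (oth x)) ^ Suc (Suc k)) * symw p (altw (oth x) (Suc (2 * Suc k))) v else 0)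
         + (if y = oth x then symw p (altw x (Suc (2 * Suc k))) v else 0)"
        using symw_altw_Suc[OF 2, of "2 * Suc k" v y] prod_altw(2)[OF 2, of "Suc k"] fl
        by (simp only: mult_Suc_right add_2_eq_Suc) auto
      show ?thesis
        unfolding snoc eq sn[OF 2] sn[OF z'] odd[OF 2] odd[OF z']
        using fl by (auto simp del: power_Suc altw.simps mult_Suc_right)
    qed }
qed

text \<open>Dropping the prefix \<open>u\<close> leaves an alternating word, whose first two letters
  cannot agree.\<close>

lemma altw_neq_square:
  assumes "y \<in> {1,2}"
  shows "altw y n \<noteq> u @ x # x # v"
proof
  assume "altw y n = u @ x # x # v"
  then have "drop (length u) (altw y n) = x # x # v" by simp
  then have "altw (if even (length u) then y else oth y) (n - length u) = x # x # v"
    using drop_altw[OF assms] by simp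
  moreover have "z \<noteq> oth z" for z by (simp add: oth_def)
  moreover obtain z m where "altw (if even (length u) then y else oth y) (n - length u) = altw z m"
    by blast
  ultimately show False by (cases m; cases "m - 1") auto
qed

text \<open>The type \<open>tens\<close> admits arbitrary natural numbers as letters. Restricting to
  1 and 2 also makes the index set in \<open>symz\<close> finite.\<close>

definition supported :: "'a tens \<Rightarrow> bool" where
  "supported f \<longleftrightarrow> (\<forall>w. f w \<noteq> 0 \<longrightarrow> set w \<subseteq> {1,2})"

text \<open>Degree zero is separate because \<open>altw 1 0\<close> and \<open>altw 2 0\<close> are
  both the empty word, which a sum over the two starting letters would count twice.\<close>

lemma symz_eq:
  assumes "supported f"
  shows "symz p m f u = (if m = 0 then f [] * wrd [] u
    else \<Sum>x\<in>{1,2}. f (altw x m) * symw p (altw x m) u)"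
proof -
  have fin: "finite {w. set w \<subseteq> {1,2::nat} \<and> length w = m}"
    by (rule finite_lists_length_eq) simp
  have "symz p m f u = (\<Sum>w\<in>(\<lambda>x. altw x m) ` {1,2}. f w * symw p w u)"
    unfolding symz_def
  proof (rule sum.mono_neutral_cong)
    show "finite {w. length w = m \<and> f w \<noteq> 0}"
      by (rule finite_subset[OF _ fin]) (use assms in \<open>auto simp: supported_def\<close>)
    fix w assume w: "w \<in> {w. length w = m \<and> f w \<noteq> 0} - (\<lambda>x. altw x m) ` {1,2}"
    then have "set w \<subseteq> {1,2}" using assms by (auto simp: supported_def)
    then show "f w * symw p w u = 0"
    proof (cases rule: word_cases)
      case (1 x)
      then have "w = altw x m" using w by simp
      then show ?thesis using w 1(1) by blast
    next
      case (2 x u v)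
      then show ?thesis by (simp add: symw_letter_square)
    qed
  qed auto
  then show ?thesis
    by (cases m) (auto simp: altw_eq_iff symw_Nil)
qed

text \<open>The conditions are the coefficients of the symmetrized element at the alternating words,
  by \<open>symw_altw\<close>. In even degree the two conditions are equivalent if q^(k+1) = 1 and
  force both coefficients to vanish otherwise.\<close>

lemma nichols_zero_iff:
  assumes "supported f"
  shows "nichols_zero p f \<longleftrightarrow> f [] = 0 \<and> (\<forall>k. qpoch k \<noteq> 0 \<longrightarrow> (\<forall>x\<in>{1,2}.
    f (altw x (Suc (2 * k))) = 0 \<and>
    f (altw x (2 * Suc k)) = (- p (oth x) x) ^ Suc k * f (altw (oth x) (2 * Suc k))))"
    (is "_ \<longleftrightarrow> ?r")
proof -
  have zero: "symz p 0 f u = f [] * wrd [] u" for u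
    using symz_eq[OF assms, of 0 u] by simp
  have odd: "symz p (Suc (2 * k)) f u
      = (\<Sum>x\<in>{1,2}. qpoch k * f (altw x (Suc (2 * k))) * wrd (altw x (Suc (2 * k))) u)" for k u
    using symz_eq[OF assms, of "Suc (2 * k)" u]
    by (simp add: symw_altw(1) del: altw.simps)
  have even: "symz p (2 * Suc k) f u
      = (\<Sum>x\<in>{1,2}. qpoch k * (f (altw x (2 * Suc k))
          - (- p (oth x) x) ^ Suc k * f (altw (oth x) (2 * Suc k))) * wrd (altw x (2 * Suc k)) u)" for k u
    using symz_eq[OF assms, of "2 * Suc k" u]
      symw_altw(2)[of 1 k u] symw_altw(2)[of 2 k u]
    by (simp del: altw.simps power_Suc mult_Suc_right) (simp only: algebra_simps)
  show ?thesis
  proof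
    assume z: "nichols_zero p f"
    have "f [] = 0" using z zero[of "[]"] by (simp add: nichols_zero_def wrd_def)
    moreover have "f (altw x (Suc (2 * k))) = 0"
      "f (altw x (2 * Suc k)) = (- p (oth x) x) ^ Suc k * f (altw (oth x) (2 * Suc k))"
      if "qpoch k \<noteq> 0" "x \<in> {1,2}" for k x
      using that z odd[of k "altw x (Suc (2 * k))"] even[of k "altw x (2 * Suc k)"]
      by (auto simp: nichols_zero_def wrd_def altw_eq_iff simp del: altw.simps power_Suc mult_Suc_right)
    ultimately show ?r by blast
  next
    assume r: ?r
    have "symz p m f u = 0" for m u
    proof -
      consider "m = 0" | k where "m = Suc (2 * k)" | k where "m = 2 * Suc k"
        by (metis even_Suc evenE not0_implies_Suc oddE Suc_eq_plus1 mult_0_right)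
      then show ?thesis
      proof cases
        case 1
        then show ?thesis using r zero by simp
      next
        case (2 k)
        show ?thesis unfolding 2 odd by (rule sum.neutral) (use r in \<open>metis mult_zero_left mult_zero_right\<close>)
      next
        case (3 k)
        show ?thesis unfolding 3 even
          by (rule sum.neutral) (use r in \<open>metis mult_zero_left mult_zero_right right_minus_eq\<close>)
      qed
    qed
    then show "nichols_zero p f" by (simp add: nichols_zero_def)
  qed
qed

text \<open>A factor 1 - q^n vanishes for some n in 1, ..., \<open>k\<close> exactly when the least
  such exponent, the order, is at most \<open>k\<close>.\<close>

lemma qpoch_nonzero_iff: "qpoch k \<noteq> 0 \<longleftrightarrow> enat k < mord q"
proof -
  have "qpoch k = 0 \<longleftrightarrow> (\<exists>n. 0 < n \<and> n \<le> k \<and> q ^ n = 1)"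
  proof
    assume "qpoch k = 0"
    then obtain i where "i < k" "q ^ Suc i = 1" by (auto simp: qpoch_def simp del: power_Suc)
    then show "\<exists>n. 0 < n \<and> n \<le> k \<and> q ^ n = 1" by (intro exI[of _ "Suc i"]) auto
  next
    assume "\<exists>n. 0 < n \<and> n \<le> k \<and> q ^ n = 1"
    then obtain n where n: "0 < n" "n \<le> k" "q ^ n = 1" by blast
    then have "1 - q ^ Suc (n - 1) = 0" "n - 1 < k" by auto
    then show "qpoch k = 0" unfolding qpoch_def by (intro prod_zero) blast+
  qed
  also have "\<dots> \<longleftrightarrow> mord q \<le> enat k"
  proof
    assume "\<exists>n. 0 < n \<and> n \<le> k \<and> q ^ n = 1"
    then obtain n where n: "0 < n" "n \<le> k" "q ^ n = 1" by blast
    then have "(LEAST n. n > 0 \<and> q ^ n = 1) \<le> n" by (intro Least_le) auto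
    with n show "mord q \<le> enat k" by (auto simp: mord_def)
  next
    assume le: "mord q \<le> enat k"
    then have ex: "\<exists>n>0. q ^ n = 1" by (auto simp: mord_def split: if_splits)
    then have "(LEAST n. n > 0 \<and> q ^ n = 1) \<le> k" using le by (simp add: mord_def)
    moreover have "(LEAST n. n > 0 \<and> q ^ n = 1) > 0 \<and> q ^ (LEAST n. n > 0 \<and> q ^ n = 1) = 1"
      using LeastI_ex[of "\<lambda>n. n > 0 \<and> q ^ n = 1"] ex by auto
    ultimately show "\<exists>n. 0 < n \<and> n \<le> k \<and> q ^ n = 1" by blast
  qed
  finally show ?thesis by (simp add: not_le[symmetric])
qed

section \<open>Coordinates on the Lie algebra\<close>

lemma chi_Cons: "chi p (x # v) u = prod_list (map (p x) u) * chi p v u"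
  by (simp add: chi_def prod.lessThan_Suc_shift prod.list_conv_set_nth atLeast0LessThan del: prod.lessThan_Suc)

text \<open>The bicharacter depends only on the degrees of the two words, and pairs of equal letters
  contribute -1 each.\<close>

lemma chi_count:
  assumes "set v \<subseteq> {1,2}" "set u \<subseteq> {1,2}"
  shows "chi p v u = (-1) ^ (count_list v 1 * count_list u 1 + count_list v 2 * count_list u 2)
    * p 1 2 ^ (count_list v 1 * count_list u 2) * p 2 1 ^ (count_list v 2 * count_list u 1)"
proof -
  have row: "prod_list (map (p x) u) = p x 1 ^ count_list u 1 * p x 2 ^ count_list u 2" for x
    using assms(2) by (induction u) (auto simp: power_add)
  show ?thesis using assms(1)
  proof (induction v)
    case Nil
    then show ?case by (simp add: chi_def)
  next
    case (Cons x v)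
    then show ?case
      by (auto simp: chi_Cons row p11 p22 power_add algebra_simps)
  qed
qed

lemma count_altw:
  assumes "x \<in> {1,2}"
  shows "count_list (altw x (2 * k)) 1 = k" (is ?c1) and "count_list (altw x (2 * k)) 2 = k" (is ?c2)
    and "count_list (altw x (Suc (2 * k))) x = Suc k" "count_list (altw x (Suc (2 * k))) (oth x) = k"
proof -
  have "?c1 \<and> ?c2" using assms by (induction k) auto
  then show ?c1 ?c2 by auto
  then show "count_list (altw x (Suc (2 * k))) x = Suc k" "count_list (altw x (Suc (2 * k))) (oth x) = k"
    unfolding altw_snoc[OF assms] using assms by auto
qed

text \<open>The two ways to cut an alternating word of even length: at an even position both pieces
  start with \<open>x\<close>, at an odd position both pieces have odd length and start with
  different letters.\<close>

lemma chi_altw: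
  assumes "x \<in> {1,2}"
  shows "chi p (altw x (2 * i)) (altw x (2 * j)) = q ^ (i * j)"
    and "chi p (altw (oth x) (Suc (2 * i))) (altw x (Suc (2 * j)))
      = (-1) ^ (i + j) * q ^ (i * j) * p (oth x) x ^ Suc (i + j)"
proof -
  have set: "set (altw 1 n) \<subseteq> {1,2}" "set (altw 2 n) \<subseteq> {1,2}" for n
    by (rule set_altw; simp)+
  have even: "(-1) ^ (a + a) = (1::'a)" for a by (simp add: power_add[symmetric] mult_2[symmetric])
  show "chi p (altw x (2 * i)) (altw x (2 * j)) = q ^ (i * j)"
    using assms set_altw[OF assms]
    by (simp add: chi_count count_altw even q_def power_mult_distrib)
  have sgn: "(-1) ^ (i * Suc j + Suc i * j) = ((-1) ^ (i + j) :: 'a)"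
    "(-1) ^ (Suc i * j + i * Suc j) = ((-1) ^ (i + j) :: 'a)"
    by (auto simp: minus_one_power_iff)
  show "chi p (altw (oth x) (Suc (2 * i))) (altw x (Suc (2 * j)))
      = (-1) ^ (i + j) * q ^ (i * j) * p (oth x) x ^ Suc (i + j)"
    using assms count_altw(3)[of 1] count_altw(3)[of 2] count_altw(4)[of 1] count_altw(4)[of 2]
    by (auto simp: chi_count[OF set(2) set(1)] chi_count[OF set(1) set(2)] sgn q_def
        power_mult_distrib power_add mult_ac simp del: altw.simps)
qed

text \<open>At \<open>k = 0\<close> both words are empty and the relation reads 2 f [] = 0, so in
  characteristic zero it also excludes a constant term.\<close>

definition balanced :: "'a tens \<Rightarrow> bool" where
  "balanced f \<longleftrightarrow> (\<forall>k. p 1 2 ^ k * f (altw 1 (2 * k)) + p 2 1 ^ k * f (altw 2 (2 * k)) = 0)"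

text \<open>\<open>tens\<close> contains functions of infinite support; this invariant keeps the
  expansion in the basis finite.\<close>

definition bounded_length :: "'a tens \<Rightarrow> bool" where
  "bounded_length f \<longleftrightarrow> (\<exists>N. \<forall>w. f w \<noteq> 0 \<longrightarrow> length w \<le> N)"

lemma lbr_nonzero:
  assumes "lbr p f g w \<noteq> 0"
  obtains u v where "w = u @ v" "f u \<noteq> 0 \<and> g v \<noteq> 0 \<or> g u \<noteq> 0 \<and> f v \<noteq> 0"
proof -
  obtain i where "f (take i w) * g (drop i w) - g (take i w) * f (drop i w) \<noteq> 0"
    using assms unfolding lbr_def by (metis (no_types, lifting) mult_zero_right sum.neutral)
  then show ?thesis
    by (intro that[of "take i w" "drop i w"]) auto
qed

lemma supported_lbr: "supported f \<Longrightarrow> supported g \<Longrightarrow> supported (lbr p f g)"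
  unfolding supported_def by (metis lbr_nonzero set_append Un_subset_iff)

lemma bounded_length_lbr:
  assumes "bounded_length f" "bounded_length g"
  shows "bounded_length (lbr p f g)"
proof -
  obtain M N where M: "\<And>w. f w \<noteq> 0 \<Longrightarrow> length w \<le> M" and N: "\<And>w. g w \<noteq> 0 \<Longrightarrow> length w \<le> N"
    using assms by (auto simp: bounded_length_def)
  have "length w \<le> M + N" if "lbr p f g w \<noteq> 0" for w
    using that by (rule lbr_nonzero) (use M N in \<open>fastforce dest: M N\<close>)
  then show ?thesis by (auto simp: bounded_length_def)
qed

text \<open>Reversing the splitting \<open>(i, 2k-i)\<close> of the two alternating words changes the sign of each
  summand of the combined sum, so the sum equals its negative.\<close>
lemma balanced_lbr: "balanced (lbr p f g)"
  unfolding balanced_def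
proof
  fix k
  let ?z = "\<lambda>x i. if even i then x else oth x"
  define T where "T x i = chi p (altw (?z x i) (2 * k - i)) (altw x i) *
    (f (altw x i) * g (altw (?z x i) (2 * k - i)) - g (altw x i) * f (altw (?z x i) (2 * k - i)))" for x i
  define S where "S i = p 1 2 ^ k * T 1 i + p 2 1 ^ k * T 2 i" for i
  have lbr: "lbr p f g (altw x (2 * k)) = (\<Sum>i\<le>2 * k. T x i)" if "x \<in> {1,2}" for x
    using that by (auto simp: lbr_def T_def take_altw drop_altw intro!: sum.cong)
  have eq: "p 1 2 ^ k * lbr p f g (altw 1 (2 * k)) + p 2 1 ^ k * lbr p f g (altw 2 (2 * k))
      = (\<Sum>i\<le>2 * k. S i)"
    by (simp add: lbr S_def sum.distrib sum_distrib_left)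
  have anti: "S (2 * k - i) = - S i" if "i \<le> 2 * k" for i
  proof (cases "even i")
    case True
    \<comment> \<open>Even cut: exchanging the pieces gives the same word and the same bicharacter,
      so only the antisymmetry in \<open>f\<close> and \<open>g\<close> is seen.\<close>
    then obtain j where j: "i = 2 * j" by auto
    obtain l where l: "k = j + l" using \<open>i \<le> 2 * k\<close> j le_Suc_ex by auto
    have "T x (2 * k - i) = - T x i" if "x \<in> {1,2}" for x
      using chi_altw(1)[OF that] by (simp add: T_def j l mult.commute algebra_simps)
    then show ?thesis by (simp add: S_def)
  next
    case False
    then obtain j where j: "i = Suc (2 * j)" by (auto elim: oddE)
    obtain l where l: "k = Suc (l + j)" using \<open>i \<le> 2 * k\<close> j le_Suc_ex[of "Suc j" k] by auto
    \<comment> \<open>Odd cut: exchanging the pieces turns the word starting with 1 into the one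
      starting with 2. The weights \<open>p 1 2 ^ k\<close> and \<open>p 2 1 ^ k\<close> even out
      the two bicharacters.\<close>
    have swap: "p 1 2 ^ k * T 1 (Suc (2 * l)) = - (p 2 1 ^ k * T 2 (Suc (2 * j)))"
      if k: "k = Suc (l + j)" for j l
    proof -
      have "chi p (altw 2 (Suc (2 * j))) (altw 1 (Suc (2 * l))) = (-1) ^ (l + j) * q ^ (l * j) * p 2 1 ^ k"
        "chi p (altw 1 (Suc (2 * l))) (altw 2 (Suc (2 * j))) = (-1) ^ (l + j) * q ^ (l * j) * p 1 2 ^ k"
        using chi_altw(2)[of 1 j l] chi_altw(2)[of 2 l j]
        by (simp_all add: k add.commute mult.commute del: power_Suc altw.simps)
      moreover have "2 * k - Suc (2 * l) = Suc (2 * j)" "2 * k - Suc (2 * j) = Suc (2 * l)"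
        using k by auto
      ultimately show ?thesis
        by (simp add: T_def algebra_simps del: altw.simps)
    qed
    have "2 * k - i = Suc (2 * l)" using j l by simp
    then show ?thesis
      using swap[of l j] swap[of j l] l unfolding S_def j by (simp add: add.commute)
  qed
  have "(\<Sum>i\<le>2 * k. S i) = (\<Sum>i\<le>2 * k. S (2 * k - i))"
    by (rule sum.reindex_bij_witness[of _ "\<lambda>i. 2 * k - i" "\<lambda>i. 2 * k - i"]) auto
  also have "\<dots> = - (\<Sum>i\<le>2 * k. S i)"
    by (simp add: anti sum_negf)
  \<comment> \<open>A sum equal to its own negative is zero in characteristic zero.\<close>
  finally show "p 1 2 ^ k * lbr p f g (altw 1 (2 * k)) + p 2 1 ^ k * lbr p f g (altw 2 (2 * k)) = 0"
    unfolding eq by (metis eq_neg_iff_add_eq_0 mult_2 mult_eq_0_iff zero_neq_numeral)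
qed

text \<open>The generators have odd length, so they are balanced trivially, and every bracket is
  balanced by \<open>balanced_lbr\<close>. This is the upper bound on the Lie algebra.\<close>

lemma Lgen_invariants:
  assumes "l \<in> Lgen p"
  shows "supported l \<and> bounded_length l \<and> balanced l"
  using assms
proof (induction rule: Lgen.induct)
  case gen1
  show ?case
    by (auto simp: supported_def bounded_length_def balanced_def wrd_def)
       (metis altw.simps length_altw length_Cons list.size(3) even_Suc even_mult_iff even_zero even_numeral)+
next
  case gen2
  show ?case
    by (auto simp: supported_def bounded_length_def balanced_def wrd_def)
       (metis altw.simps length_altw length_Cons list.size(3) even_Suc even_mult_iff even_zero even_numeral)+
next
  case (add f g)
  then obtain M N where "\<And>w. f w \<noteq> 0 \<Longrightarrow> length w \<le> M" "\<And>w. g w \<noteq> 0 \<Longrightarrow> length w \<le> N"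
    by (auto simp: bounded_length_def)
  then have "\<And>w. tadd f g w \<noteq> 0 \<Longrightarrow> length w \<le> max M N"
    unfolding tadd_def le_max_iff_disj by (metis add.left_neutral)
  then have "bounded_length (tadd f g)" by (auto simp: bounded_length_def)
  moreover have "supported (tadd f g)"
    using add.IH unfolding supported_def tadd_def by (metis add.left_neutral)
  moreover have "balanced (tadd f g)"
    unfolding balanced_def
  proof
    fix k
    have "p 1 2 ^ k * tadd f g (altw 1 (2 * k)) + p 2 1 ^ k * tadd f g (altw 2 (2 * k))
      = (p 1 2 ^ k * f (altw 1 (2 * k)) + p 2 1 ^ k * f (altw 2 (2 * k)))
      + (p 1 2 ^ k * g (altw 1 (2 * k)) + p 2 1 ^ k * g (altw 2 (2 * k)))"
      by (simp add: tadd_def algebra_simps)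
    then show "p 1 2 ^ k * tadd f g (altw 1 (2 * k)) + p 2 1 ^ k * tadd f g (altw 2 (2 * k)) = 0"
      using add.IH by (simp add: balanced_def)
  qed
  ultimately show ?case by blast
next
  case (smult f c)
  have "balanced (tsmult c f)"
    unfolding balanced_def
  proof
    fix k
    have "p 1 2 ^ k * tsmult c f (altw 1 (2 * k)) + p 2 1 ^ k * tsmult c f (altw 2 (2 * k))
      = c * (p 1 2 ^ k * f (altw 1 (2 * k)) + p 2 1 ^ k * f (altw 2 (2 * k)))"
      by (simp add: tsmult_def algebra_simps)
    then show "p 1 2 ^ k * tsmult c f (altw 1 (2 * k)) + p 2 1 ^ k * tsmult c f (altw 2 (2 * k)) = 0"
      using smult.IH by (simp add: balanced_def)
  qed
  then show ?case using smult.IH by (auto simp: supported_def bounded_length_def tsmult_def)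
next
  case (brk f g)
  then show ?case using supported_lbr bounded_length_lbr balanced_lbr by blast
qed

section \<open>Brackets that produce the family\<close>

lemma lbr_wrd: "lbr p (wrd u) (wrd v) t = chi p v u * wrd (u @ v) t - chi p u v * wrd (v @ u) t"
proof -
  have "(\<Sum>i\<le>length t. chi p (drop i t) (take i t) * (wrd u (take i t) * wrd v (drop i t)))
      = chi p v u * wrd (u @ v) t" for u v
  proof (cases "t = u @ v")
    case True
    \<comment> \<open>Only the cut at \<open>length u\<close> has a first piece of the right
      length.\<close>
    have "wrd u (take i t) = (0::'a)" if "i \<in> {..length t} - {length u}" for i
    proof -
      have "length (take i t) = i" using that by simp
      then have "take i t \<noteq> u" using that by auto
      then show ?thesis by (simp add: wrd_def)
    qed
    with True have "(\<Sum>i\<le>length t. chi p (drop i t) (take i t) * (wrd u (take i t) * wrd v (drop i t)))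
       = (\<Sum>i\<in>{length u}. chi p (drop i t) (take i t) * (wrd u (take i t) * wrd v (drop i t)))"
      by (intro sum.mono_neutral_right) auto
    then show ?thesis using True by (simp add: wrd_def)
  next
    case False
    have "wrd u (take i t) * wrd v (drop i t) = (0::'a)" for i
      using False append_take_drop_id[of i t] by (auto simp: wrd_def)
    moreover have "wrd (u @ v) t = (0::'a)" using False by (simp add: wrd_def)
    ultimately show ?thesis by (simp only: mult_zero_right sum.neutral_const)
  qed
  from this[of u v] this[of v u] show ?thesis
    by (simp add: lbr_def right_diff_distrib sum_subtractf)
qed

text \<open>Agreement up to words with a square, which the quantum symmetrizer kills.\<close>

definition alt_eq :: "'a tens \<Rightarrow> 'a tens \<Rightarrow> bool" where
  "alt_eq f g \<longleftrightarrow> (\<forall>x\<in>{1,2}. \<forall>n. f (altw x n) = g (altw x n))"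

lemma alt_eqI: "(\<And>x n. x \<in> {1,2} \<Longrightarrow> f (altw x n) = g (altw x n)) \<Longrightarrow> alt_eq f g"
  by (simp add: alt_eq_def)

lemma alt_eqD: "alt_eq f g \<Longrightarrow> x \<in> {1,2} \<Longrightarrow> f (altw x n) = g (altw x n)"
  by (auto simp: alt_eq_def)

text \<open>Both pieces of a cut alternating word are alternating again, so the bracket respects
  \<open>alt_eq\<close>.\<close>

lemma lbr_alt_cong:
  assumes "alt_eq f f'" "alt_eq g g'"
  shows "alt_eq (lbr p f g) (lbr p f' g')"
proof (rule alt_eqI)
  fix x :: nat and n assume x: "x \<in> {1,2}"
  have z: "(if even i then x else oth x) \<in> {1,2}" for i :: nat using x by auto
  show "lbr p f g (altw x n) = lbr p f' g' (altw x n)"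
    unfolding lbr_def
    by (intro sum.cong refl)
       (simp only: length_altw atMost_iff take_altw drop_altw[OF x] alt_eqD[OF assms(1) x]
         alt_eqD[OF assms(2) x] alt_eqD[OF assms(1) z] alt_eqD[OF assms(2) z])
qed

lemma wrd_square_altw: "y \<in> {1,2} \<Longrightarrow> wrd (u @ x # x # v) (altw y n) = 0"
  by (simp add: wrd_def altw_neq_square)

lemma lbr_tdiff_left:
  "lbr p (tdiff (tsmult a f) (tsmult b g)) h t = a * lbr p f h t - b * lbr p g h t"
  by (simp add: lbr_def tdiff_def tsmult_def sum_distrib_left sum_subtractf[symmetric] algebra_simps)

definition even_elt :: "nat \<Rightarrow> 'a tens" where
  "even_elt k = (\<lambda>t. p 2 1 ^ Suc k * wrd (altw 1 (2 * Suc k)) t - p 1 2 ^ Suc k * wrd (altw 2 (2 * Suc k)) t)"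

lemma P2fam_eq:
  "P2fam p (0, k) = even_elt k"
  "P2fam p (1, k) = wrd (altw 2 (Suc (2 * k)))"
  "P2fam p (2, k) = wrd (altw 1 (Suc (2 * k)))"
  using altw_snoc[of 1 "2 * k"]
  by (simp_all add: P2fam_def even_elt_def tdiff_def tsmult_def x12pow_eq x21pow_eq fun_eq_iff
      del: altw.simps power_Suc mult_Suc_right) (simp_all add: power_add)

text \<open>Putting x1x2 or x2x1 before or after the odd word gives four words. Two contain a square
  and drop out; the other two are both the next odd word.\<close>

lemma bracket_step:
  assumes x: "x \<in> {1,2}"
  shows "\<exists>c. c \<noteq> 0 \<and> alt_eq (lbr p (even_elt 0) (wrd (altw x (Suc (2 * k)))))
    (tsmult c (wrd (altw x (Suc (2 * Suc k)))))"
proof -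
  let ?w = "altw x (Suc (2 * k))"
  have w: "?w = altw x (2 * k) @ [x]" using altw_snoc[OF x, of "2 * k"] by simp
  have w': "?w = x # altw (oth x) (2 * k)" by simp
  note fl = letter_flip[OF x]
  have pair: "altw z 2 = [z, oth z]" for z by (simp only: numeral_2_eq_2 altw.simps)
  have "?w @ altw (oth x) 2 = altw x (Suc (2 * Suc k))"
    using altw_append[OF x, of "Suc (2 * k)" 2] by simp
  moreover have "[x, oth x] @ ?w = altw x (Suc (2 * Suc k))" using fl by simp
  ultimately have long: "?w @ [oth x, x] = altw x (Suc (2 * Suc k))" "[x, oth x] @ ?w = altw x (Suc (2 * Suc k))"
    using fl by (simp_all only: pair)
  have vanish: "wrd (?w @ [x, oth x]) (altw y n) = (0::'a)" "wrd ([oth x, x] @ ?w) (altw y n) = (0::'a)"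
    if "y \<in> {1,2}" for y n
    using wrd_square_altw[OF that, of "altw x (2 * k)" x "[oth x]"]
      wrd_square_altw[OF that, of "[oth x]" x "altw (oth x) (2 * k)"] w w' by simp_all
  have set: "set (altw 1 n) \<subseteq> {1,2}" "set (altw 2 n) \<subseteq> {1,2}" for n
    by (rule set_altw; simp)+
  have chi: "chi p ?w [x, oth x] = - p x (oth x) * q ^ k" "chi p [oth x, x] ?w = - p (oth x) x * q ^ k"
    using x count_altw(3)[of 1] count_altw(3)[of 2] count_altw(4)[of 1] count_altw(4)[of 2]
    by (auto simp: chi_count set power_add q_def power_mult_distrib minus_one_power_iff simp del: altw.simps)
  \<comment> \<open>The two surviving contributions have the same sign and add up, which gives the
    factor 2; it is nonzero in characteristic zero.\<close>
  define c where "c = (if x = 1 then - 2 else 2) * q ^ Suc k"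
  have "c \<noteq> 0" using p12 p21 by (auto simp: c_def q_def)
  moreover have "lbr p (even_elt 0) (wrd ?w) (altw y n) = c * wrd (altw x (Suc (2 * Suc k))) (altw y n)"
    if y: "y \<in> {1,2}" for y n
  proof -
    have "even_elt 0 = tdiff (tsmult (p 2 1) (wrd [1,2])) (tsmult (p 1 2) (wrd [2,1]))"
      by (simp add: even_elt_def tdiff_def tsmult_def pair)
    then have lin: "lbr p (even_elt 0) (wrd ?w) (altw y n)
      = p 2 1 * lbr p (wrd [1,2]) (wrd ?w) (altw y n) - p 1 2 * lbr p (wrd [2,1]) (wrd ?w) (altw y n)"
      by (simp only: lbr_tdiff_left)
    have "lbr p (wrd [x, oth x]) (wrd ?w) (altw y n)
        = - p x (oth x) * q ^ k * wrd (altw x (Suc (2 * Suc k))) (altw y n)"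
      "lbr p (wrd [oth x, x]) (wrd ?w) (altw y n)
        = p (oth x) x * q ^ k * wrd (altw x (Suc (2 * Suc k))) (altw y n)"
      unfolding lbr_wrd long vanish[OF y] chi by simp_all
    then have "lbr p (even_elt 0) (wrd ?w) (altw y n) = (if x = 1
      then p 2 1 * (- p 1 2 * q ^ k * wrd (altw x (Suc (2 * Suc k))) (altw y n))
         - p 1 2 * (p 2 1 * q ^ k * wrd (altw x (Suc (2 * Suc k))) (altw y n))
      else p 2 1 * (p 1 2 * q ^ k * wrd (altw x (Suc (2 * Suc k))) (altw y n))
         - p 1 2 * (- p 2 1 * q ^ k * wrd (altw x (Suc (2 * Suc k))) (altw y n)))"
      unfolding lin using x by (auto simp del: altw.simps)
    then show ?thesis
      by (simp add: c_def q_def algebra_simps del: altw.simps)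
  qed
  ultimately show ?thesis by (intro exI[of _ c]) (simp add: alt_eq_def tsmult_def del: altw.simps)
qed

lemma lbr_generators: "lbr p (wrd [1]) (wrd [2]) = even_elt 0"
proof -
  have pair: "altw z 2 = [z, oth z]" for z by (simp only: numeral_2_eq_2 altw.simps)
  show ?thesis
    by (simp add: lbr_wrd even_elt_def pair chi_count fun_eq_iff)
qed

text \<open>Repeated bracketing with [x1,x2]_L lengthens the word by two letters up to a nonzero
  scalar. Only \<open>alt_eq\<close> is claimed because the brackets also contain words with
  squares.\<close>

lemma odd_in_Lgen:
  assumes x: "x \<in> {1,2}"
  shows "\<exists>l\<in>Lgen p. alt_eq l (wrd (altw x (Suc (2 * k))))"
proof (induction k)
  case 0
  show ?case using x Lgen.gen1[of p] Lgen.gen2[of p] by (auto simp: alt_eq_def)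
next
  case (Suc k)
  then obtain l where l: "l \<in> Lgen p" "alt_eq l (wrd (altw x (Suc (2 * k))))" by blast
  obtain c where c: "c \<noteq> 0" "alt_eq (lbr p (even_elt 0) (wrd (altw x (Suc (2 * k)))))
    (tsmult c (wrd (altw x (Suc (2 * Suc k)))))"
    using bracket_step[OF x] by blast
  have "alt_eq (lbr p (even_elt 0) l) (lbr p (even_elt 0) (wrd (altw x (Suc (2 * k)))))"
    by (rule lbr_alt_cong) (use l in \<open>auto simp: alt_eq_def\<close>)
  with c have "alt_eq (tsmult (inverse c) (lbr p (even_elt 0) l)) (wrd (altw x (Suc (2 * Suc k))))"
    by (simp add: alt_eq_def tsmult_def del: altw.simps)
  moreover have "tsmult (inverse c) (lbr p (even_elt 0) l) \<in> Lgen p"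
    unfolding lbr_generators[symmetric] by (intro Lgen.intros l)
  ultimately show ?case by blast
qed

text \<open>Bracketing an odd word in x1 with x2 appends or prepends a 2. Both bicharacters carry
  the sign (-1)^k, which is its own inverse and can be scaled away.\<close>

lemma even_in_Lgen: "\<exists>l\<in>Lgen p. alt_eq l (even_elt k)"
proof -
  obtain l where l: "l \<in> Lgen p" "alt_eq l (wrd (altw 1 (Suc (2 * k))))"
    using odd_in_Lgen[of 1] by auto
  have chi: "chi p [2] (altw 1 (Suc (2 * k))) = (-1) ^ k * p 2 1 ^ Suc k"
    "chi p (altw 1 (Suc (2 * k))) [2] = (-1) ^ k * p 1 2 ^ Suc k"
    using count_altw(3,4)[of 1 k] set_altw[of 1 "Suc (2 * k)"]
    by (simp_all add: chi_count power_add del: altw.simps)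
  have words: "altw 1 (Suc (2 * k)) @ [2] = altw 1 (2 * Suc k)" "[2] @ altw 1 (Suc (2 * k)) = altw 2 (2 * Suc k)"
    using altw_snoc[of 1 "Suc (2 * k)"] by simp_all
  have "lbr p (wrd (altw 1 (Suc (2 * k)))) (wrd [2]) = tsmult ((-1) ^ k) (even_elt k)"
    by (simp only: fun_eq_iff lbr_wrd chi words even_elt_def tsmult_def) (simp add: right_diff_distrib mult.assoc)
  moreover have "alt_eq (lbr p l (wrd [2])) (lbr p (wrd (altw 1 (Suc (2 * k)))) (wrd [2]))"
    by (rule lbr_alt_cong) (use l in \<open>auto simp: alt_eq_def\<close>)
  ultimately have "alt_eq (tsmult ((-1) ^ k) (lbr p l (wrd [2]))) (even_elt k)"
    by (simp add: alt_eq_def tsmult_def mult.assoc[symmetric] power_add[symmetric] mult_2[symmetric])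
  moreover have "tsmult ((-1) ^ k) (lbr p l (wrd [2])) \<in> Lgen p"
    by (intro Lgen.intros l)
  ultimately show ?thesis by blast
qed

section \<open>Vanishing in the Nichols algebra in terms of coordinates\<close>

lemma balancedD: "balanced f \<Longrightarrow> p 1 2 ^ k * f (altw 1 (2 * k)) = - (p 2 1 ^ k * f (altw 2 (2 * k)))"
  by (simp add: balanced_def eq_neg_iff_add_eq_0)

text \<open>For a balanced element the coefficient at \<open>altw 1 (2 * Suc k)\<close> determines
  the one at \<open>altw 2 (2 * Suc k)\<close>, so one coordinate suffices there. The denominator
  makes the coordinate of \<open>even_elt k\<close> equal to 1.\<close>

fun coord :: "'a tens \<Rightarrow> nat \<times> nat \<Rightarrow> 'a" where
  "coord f (t, k) = (if t = 0 then f (altw 1 (2 * Suc k)) / p 2 1 ^ Suc k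
     else f (altw (if t = 1 then 2 else 1) (Suc (2 * k))))"

text \<open>Write a = (-p12)^(k+1), b = (-p21)^(k+1), and A, B for the two even coefficients.
  Balance gives aA = -bB, and vanishing means A = bB and B = aA. Together they yield B = -A, hence A
  = 0 or a = b = -1. In the latter case balance alone implies vanishing, which is why that index is
  removed.\<close>

lemma nichols_zero_coord:
  assumes "supported f" "balanced f"
  shows "nichols_zero p f \<longleftrightarrow> (\<forall>j\<in>P2idx p. coord f j = 0)"
proof -
  have f0: "f [] = 0" using balancedD[OF assms(2), of 0] by (simp add: eq_neg_iff_add_eq_0 mult_2[symmetric])
  define A B where "A k = f (altw 1 (2 * Suc k))" and "B k = f (altw 2 (2 * Suc k))" for k
  have bal: "p 1 2 ^ Suc k * A k = - (p 2 1 ^ Suc k * B k)" for k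
    using balancedD[OF assms(2), of "Suc k"] by (simp only: A_def B_def)
  have idx: "(t, k) \<in> P2idx p \<longleftrightarrow> t < 3 \<and> qpoch k \<noteq> 0 \<and>
     \<not> (t = 0 \<and> (- p 2 1) ^ Suc k = -1 \<and> (- p 1 2) ^ Suc k = -1)" for t k
  proof -
    have "exceptional p \<and> k = the_enat (mord (p 1 2 * p 2 1)) - 1
        \<longleftrightarrow> (- p 2 1) ^ Suc k = -1 \<and> (- p 1 2) ^ Suc k = -1" if lt: "enat k < mord q"
    proof
      assume "exceptional p \<and> k = the_enat (mord (p 1 2 * p 2 1)) - 1"
      then obtain n where n: "mord q = enat n" "(- p 2 1) ^ n = -1" "(- p 1 2) ^ n = -1" "k = n - 1"
        by (auto simp: exceptional_def q_def)
      then have "n = Suc k" using lt by simp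
      then show "(- p 2 1) ^ Suc k = -1 \<and> (- p 1 2) ^ Suc k = -1" using n by simp
    next
      assume e: "(- p 2 1) ^ Suc k = -1 \<and> (- p 1 2) ^ Suc k = -1"
      \<comment> \<open>The two equations multiply to q^(k+1) = 1, and as \<open>k\<close> is below
        the order, the order is exactly \<open>Suc k\<close>.\<close>
      have "q ^ Suc k = (- p 1 2) ^ Suc k * (- p 2 1) ^ Suc k"
        unfolding power_mult_distrib[symmetric] by (simp add: q_def)
      then have "q ^ Suc k = 1" using e by simp
      then have "qpoch (Suc k) = 0" unfolding qpoch_def by (intro prod_zero) auto
      then have "mord q = enat (Suc k)"
        using lt qpoch_nonzero_iff[of "Suc k"] by (cases "mord q") auto
      then show "exceptional p \<and> k = the_enat (mord (p 1 2 * p 2 1)) - 1"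
        using e by (auto simp: exceptional_def q_def simp del: power_Suc)
    qed
    then show ?thesis by (auto simp: P2idx_def qpoch_nonzero_iff q_def)
  qed
  have even: "(A k = (- p 2 1) ^ Suc k * B k \<and> B k = (- p 1 2) ^ Suc k * A k) \<longleftrightarrow>
      A k = 0 \<or> (- p 2 1) ^ Suc k = -1 \<and> (- p 1 2) ^ Suc k = -1" for k
  proof -
    define a b where "a = (- p 1 2) ^ Suc k" and "b = (- p 2 1) ^ Suc k"
    have ab: "a = (-1) ^ Suc k * p 1 2 ^ Suc k" "b = (-1) ^ Suc k * p 2 1 ^ Suc k"
      unfolding a_def b_def power_mult_distrib[symmetric] by simp_all
    have "a * A k = (-1) ^ Suc k * (p 1 2 ^ Suc k * A k)" by (simp only: ab mult.assoc)
    also have "\<dots> = - (b * B k)" by (simp only: bal ab mult.assoc mult_minus_right)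
    finally have rel: "a * A k = - (b * B k)" .
    have b0: "b \<noteq> 0" using p21 by (simp add: b_def)
    have "(A k = b * B k \<and> B k = a * A k) \<longleftrightarrow> A k = 0 \<or> b = -1 \<and> a = -1"
    proof
      assume h: "A k = b * B k \<and> B k = a * A k"
      then have B: "B k = - A k" using rel by simp
      have "A k = - (b * A k)" "- A k = a * A k" using h B by (metis mult_minus_right)+
      then have "A k + b * A k = 0" "a * A k + A k = 0"
        by (metis eq_neg_iff_add_eq_0)+
      then have "(b + 1) * A k = 0" "(a + 1) * A k = 0" by (simp_all add: distrib_right add.commute)
      then show "A k = 0 \<or> b = -1 \<and> a = -1" by (auto simp: eq_neg_iff_add_eq_0)
    next
      assume "A k = 0 \<or> b = -1 \<and> a = -1"
      then show "A k = b * B k \<and> B k = a * A k"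
      proof
        assume "A k = 0"
        then show ?thesis using rel b0 by simp
      next
        assume "b = -1 \<and> a = -1"
        then show ?thesis using rel by (metis minus_minus mult_minus1)
      qed
    qed
    then show ?thesis by (simp only: a_def b_def)
  qed
  have "nichols_zero p f \<longleftrightarrow> (\<forall>k. qpoch k \<noteq> 0 \<longrightarrow> f (altw 1 (Suc (2 * k))) = 0 \<and> f (altw 2 (Suc (2 * k))) = 0
     \<and> (A k = (- p 2 1) ^ Suc k * B k \<and> B k = (- p 1 2) ^ Suc k * A k))"
    unfolding nichols_zero_iff[OF assms(1)] by (simp add: f0 A_def B_def del: altw.simps power_Suc mult_Suc_right) blast
  also have "\<dots> \<longleftrightarrow> (\<forall>k. qpoch k \<noteq> 0 \<longrightarrow> coord f (2, k) = 0 \<and> coord f (1, k) = 0 \<and>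
      (coord f (0, k) = 0 \<or> (- p 2 1) ^ Suc k = -1 \<and> (- p 1 2) ^ Suc k = -1))"
    unfolding even using p21 by (simp add: A_def del: altw.simps power_Suc mult_Suc_right)
  also have "\<dots> \<longleftrightarrow> (\<forall>j\<in>P2idx p. coord f j = 0)"
  proof (intro iffI ballI allI impI conjI)
    fix j
    assume h: "\<forall>k. qpoch k \<noteq> 0 \<longrightarrow> coord f (2, k) = 0 \<and> coord f (1, k) = 0 \<and>
      (coord f (0, k) = 0 \<or> (- p 2 1) ^ Suc k = -1 \<and> (- p 1 2) ^ Suc k = -1)" and j: "j \<in> P2idx p"
    obtain t k where tk: "j = (t, k)" by (cases j)
    have t: "t < 3" and k: "qpoch k \<noteq> 0"
      and ex: "t \<noteq> 0 \<or> \<not> ((- p 2 1) ^ Suc k = -1 \<and> (- p 1 2) ^ Suc k = -1)"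
      using j[unfolded tk idx] by (auto simp del: power_Suc)
    from t consider "t = 0" | "t = 1" | "t = 2" by linarith
    then show "coord f j = 0"
      unfolding tk by cases (use h k ex in blast)+
  next
    fix k assume h: "\<forall>j\<in>P2idx p. coord f j = 0" and k: "qpoch k \<noteq> 0"
    have "(2, k) \<in> P2idx p" "(1, k) \<in> P2idx p"
      "(0, k) \<in> P2idx p \<or> (- p 2 1) ^ Suc k = -1 \<and> (- p 1 2) ^ Suc k = -1"
      unfolding idx using k by simp_all
    then show "coord f (2, k) = 0" "coord f (1, k) = 0"
      "coord f (0, k) = 0 \<or> (- p 2 1) ^ Suc k = -1 \<and> (- p 1 2) ^ Suc k = -1"
      using h by blast+
  qed
  finally show ?thesis .
qed

section \<open>The family, its dual coordinates and the basis property\<close>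

lemma P2fam_cases:
  assumes "j \<in> P2idx p"
  obtains k where "j = (0, k)" "P2fam p j = even_elt k"
  | k x where "x \<in> {1,2}" "j = (if x = 1 then 2 else 1, k)" "P2fam p j = wrd (altw x (Suc (2 * k)))"
proof -
  obtain t k where j: "j = (t, k)" by (cases j)
  then have "t < 3" using assms by (simp add: P2idx_def)
  then consider "t = 0" | "t = 1" | "t = 2" by linarith
  then show ?thesis
  proof cases
    case 1
    show ?thesis by (rule that(1)[of k]) (simp_all add: j 1 P2fam_eq)
  next
    case 2
    show ?thesis by (rule that(2)[of 2 k]) (simp_all add: j 2 P2fam_eq del: altw.simps)
  next
    case 3
    show ?thesis by (rule that(2)[of 1 k]) (simp_all add: j 3 P2fam_eq del: altw.simps)
  qed
qed

text \<open>The last claim is duality between \<open>coord\<close> and the family, from which both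
  independence and spanning follow.\<close>

lemma P2fam_props:
  assumes "j \<in> P2idx p"
  shows "supported (P2fam p j)" "balanced (P2fam p j)" "\<exists>l\<in>Lgen p. alt_eq l (P2fam p j)"
    and "i \<in> P2idx p \<Longrightarrow> coord (P2fam p j) i = (if i = j then 1 else 0)"
proof -
  \<comment> \<open>Separates the coordinates of odd words from those of even ones.\<close>
  have parity: "Suc (2 * k) \<noteq> 2 * n" for k n :: nat by presburger
  have sup: "supported (wrd (altw x n))" if "x \<in> {1,2}" for x n
    using set_altw[OF that] by (auto simp: supported_def wrd_def)
  have even_sup: "supported (even_elt k)" for k
    using set_altw[of 1 "2 * Suc k"] set_altw[of 2 "2 * Suc k"]
    by (auto simp: supported_def even_elt_def wrd_def simp del: altw.simps mult_Suc_right split: if_splits)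
  have even_bal: "balanced (even_elt k)" for k
    by (auto simp: balanced_def even_elt_def wrd_def altw_eq_iff simp del: altw.simps power_Suc mult_Suc_right)
  have odd_bal: "balanced (wrd (altw x (Suc (2 * k))))" for x k
    using parity by (auto simp: balanced_def wrd_def altw_eq_iff simp del: altw.simps) metis+
  show "supported (P2fam p j)"
    using assms by (rule P2fam_cases) (simp_all add: sup even_sup del: altw.simps)
  show "balanced (P2fam p j)"
    using assms by (rule P2fam_cases) (simp_all add: odd_bal even_bal del: altw.simps)
  show "\<exists>l\<in>Lgen p. alt_eq l (P2fam p j)"
    using assms by (rule P2fam_cases) (simp_all only: odd_in_Lgen even_in_Lgen)
  assume "i \<in> P2idx p"
  then obtain s n where i: "i = (s, n)" "s < 3" by (auto simp: P2idx_def)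
  show "coord (P2fam p j) i = (if i = j then 1 else 0)"
    using assms
  proof (cases rule: P2fam_cases)
    case (1 k)
    then show ?thesis
      using i p21 parity[of n "Suc k"]
      by (auto simp: even_elt_def wrd_def altw_eq_iff simp del: altw.simps power_Suc mult_Suc_right)
  next
    case (2 k x)
    then show ?thesis
      using i parity[of k "Suc n"]
      by (auto simp: wrd_def altw_eq_iff less_Suc_eq numeral_3_eq_3 simp del: altw.simps power_Suc mult_Suc_right)
  qed
qed

lemma supported_tlincomb:
  assumes "\<And>j. j \<in> J \<Longrightarrow> supported (b j)"
  shows "supported (tlincomb J c b)"
  using assms unfolding supported_def tlincomb_def
  by (metis (no_types, lifting) mult_zero_right sum.neutral)

lemma balanced_tlincomb:
  assumes "\<And>j. j \<in> J \<Longrightarrow> balanced (b j)"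
  shows "balanced (tlincomb J c b)"
  unfolding balanced_def
proof
  fix k
  have "p 1 2 ^ k * tlincomb J c b (altw 1 (2 * k)) + p 2 1 ^ k * tlincomb J c b (altw 2 (2 * k))
    = (\<Sum>j\<in>J. c j * (p 1 2 ^ k * b j (altw 1 (2 * k)) + p 2 1 ^ k * b j (altw 2 (2 * k))))"
    by (simp add: tlincomb_def sum_distrib_left sum.distrib[symmetric] algebra_simps)
  also have "\<dots> = 0" using assms by (intro sum.neutral) (auto simp: balanced_def)
  finally show "p 1 2 ^ k * tlincomb J c b (altw 1 (2 * k)) + p 2 1 ^ k * tlincomb J c b (altw 2 (2 * k)) = 0" .
qed

lemma coord_tlincomb: "coord (tlincomb J c b) i = (\<Sum>j\<in>J. c j * coord (b j) i)"
  by (cases i) (simp add: tlincomb_def sum_divide_distrib)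

lemma coord_tdiff: "coord (tdiff f g) i = coord f i - coord g i"
  by (cases i) (simp add: tdiff_def diff_divide_distrib)

lemma supported_tdiff: "supported f \<Longrightarrow> supported g \<Longrightarrow> supported (tdiff f g)"
  unfolding supported_def tdiff_def by (metis diff_zero)

lemma balanced_tdiff:
  assumes "balanced f" "balanced g"
  shows "balanced (tdiff f g)"
  unfolding balanced_def
proof
  fix k
  have "p 1 2 ^ k * tdiff f g (altw 1 (2 * k)) + p 2 1 ^ k * tdiff f g (altw 2 (2 * k))
    = (p 1 2 ^ k * f (altw 1 (2 * k)) + p 2 1 ^ k * f (altw 2 (2 * k)))
    - (p 1 2 ^ k * g (altw 1 (2 * k)) + p 2 1 ^ k * g (altw 2 (2 * k)))"
    by (simp add: tdiff_def algebra_simps)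
  then show "p 1 2 ^ k * tdiff f g (altw 1 (2 * k)) + p 2 1 ^ k * tdiff f g (altw 2 (2 * k)) = 0"
    using assms by (simp add: balanced_def)
qed

lemma coord_alt_cong: "alt_eq f g \<Longrightarrow> coord f i = coord g i"
  by (cases i) (simp add: alt_eqD del: altw.simps)

text \<open>A nonzero coordinate at index \<open>k\<close> comes from a word longer than
  \<open>k\<close>, so the length bound also bounds \<open>k\<close>.\<close>

lemma finite_coord:
  assumes "bounded_length f"
  shows "finite {i \<in> P2idx p. coord f i \<noteq> 0}"
proof -
  obtain N where N: "\<And>w. f w \<noteq> 0 \<Longrightarrow> length w \<le> N" using assms by (auto simp: bounded_length_def)
  have "{i \<in> P2idx p. coord f i \<noteq> 0} \<subseteq> {..<3} \<times> {..N}"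
    using N by (fastforce simp: P2idx_def split: if_splits)
  then show ?thesis by (rule finite_subset) simp
qed

lemma coord_tlincomb_P2fam:
  assumes "finite J" "J \<subseteq> P2idx p" "i \<in> P2idx p"
  shows "coord (tlincomb J c (P2fam p)) i = (if i \<in> J then c i else 0)"
proof -
  have "coord (tlincomb J c (P2fam p)) i = (\<Sum>j\<in>J. if i = j then c j else 0)"
    unfolding coord_tlincomb
    using P2fam_props(4)[OF subsetD[OF assms(2)] assms(3)] by (intro sum.cong) (simp_all del: coord.simps)
  then show ?thesis using assms(1) by simp
qed

lemma is_basis_P2fam: "is_basis_LV p (P2idx p) (P2fam p)"
  unfolding is_basis_LV_def
proof (intro conjI ballI allI impI)
  fix i assume i: "i \<in> P2idx p"
  then obtain l where l: "l \<in> Lgen p" "alt_eq l (P2fam p i)" using P2fam_props(3) by blast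
  then have "nichols_zero p (tdiff (P2fam p i) l)"
    using Lgen_invariants[OF l(1)] P2fam_props(1,2)[OF i]
    by (simp add: nichols_zero_coord supported_tdiff balanced_tdiff coord_tdiff coord_alt_cong)
  then show "\<exists>l\<in>Lgen p. nichols_zero p (tdiff (P2fam p i) l)" using l by blast
next
  fix J c j
  assume J: "finite J" "J \<subseteq> P2idx p" and z: "nichols_zero p (tlincomb J c (P2fam p))" and j: "j \<in> J"
  have "supported (tlincomb J c (P2fam p))" "balanced (tlincomb J c (P2fam p))"
    using P2fam_props(1,2)[OF subsetD[OF J(2)]] by (intro supported_tlincomb balanced_tlincomb; blast)+
  then have "coord (tlincomb J c (P2fam p)) j = 0" using z J j by (auto simp: nichols_zero_coord)
  then show "c j = 0" using coord_tlincomb_P2fam[OF J, of j c] J j by auto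
next
  fix l assume "l \<in> Lgen p"
  then have l: "supported l" "bounded_length l" "balanced l" using Lgen_invariants by auto
  \<comment> \<open>The expansion of \<open>l\<close> uses its own coordinates as coefficients. By
    duality the difference then has all coordinates zero.\<close>
  let ?J = "{i \<in> P2idx p. coord l i \<noteq> 0}"
  have J: "finite ?J" "?J \<subseteq> P2idx p" using finite_coord[OF l(2)] by auto
  have "supported (tlincomb ?J (coord l) (P2fam p))" "balanced (tlincomb ?J (coord l) (P2fam p))"
    using P2fam_props(1,2) by (intro supported_tlincomb balanced_tlincomb; blast)+
  moreover have "coord (tdiff l (tlincomb ?J (coord l) (P2fam p))) i = 0" if "i \<in> P2idx p" for i
    using that by (simp add: coord_tdiff coord_tlincomb_P2fam[OF J])
  ultimately have "nichols_zero p (tdiff l (tlincomb ?J (coord l) (P2fam p)))"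
    using l by (simp add: nichols_zero_coord supported_tdiff balanced_tdiff)
  then show "\<exists>J c. finite J \<and> J \<subseteq> P2idx p \<and> nichols_zero p (tdiff l (tlincomb J c (P2fam p)))"
    using J by blast
qed

end

section \<open>Change of index set and dimension\<close>

lemma is_basis_LV_reindex:
  assumes "is_basis_LV p I b" "bij_betw h K I"
  shows "is_basis_LV p K (b \<circ> h)"
proof -
  have inj: "inj_on h K" and im: "h ` K = I" using assms(2) by (auto simp: bij_betw_def)
  \<comment> \<open>Combinations over \<open>K\<close> become combinations over \<open>I\<close> by
    carrying the coefficients back along the inverse of \<open>h\<close>.\<close>
  have lin: "tlincomb J c (b \<circ> h) = tlincomb (h ` J) (c \<circ> inv_into K h) b" if "J \<subseteq> K" for J c
  proof -
    have "inj_on h J" using inj that by (rule inj_on_subset)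
    then show ?thesis
      using that inj by (auto simp: tlincomb_def fun_eq_iff sum.reindex subset_iff intro!: sum.cong)
  qed
  have indep: "d i = 0" if "finite L" "L \<subseteq> I" "nichols_zero p (tlincomb L d b)" "i \<in> L" for L d i
    using assms(1) that unfolding is_basis_LV_def by blast
  have "c j = 0" if "finite J" "J \<subseteq> K" "nichols_zero p (tlincomb J c (b \<circ> h))" "j \<in> J" for J c j
  proof -
    have "finite (h ` J)" "h ` J \<subseteq> I" "h j \<in> h ` J" using that im by auto
    then have "(c \<circ> inv_into K h) (h j) = 0"
      using that(3) unfolding lin[OF that(2)] by (intro indep[of "h ` J"])
    then show ?thesis using that inj by auto
  qed
  moreover have "\<exists>J c. finite J \<and> J \<subseteq> K \<and> nichols_zero p (tdiff l (tlincomb J c (b \<circ> h)))"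
    if "l \<in> Lgen p" for l
  proof -
    obtain J c where J: "finite J" "J \<subseteq> I" "nichols_zero p (tdiff l (tlincomb J c b))"
      using assms(1) \<open>l \<in> Lgen p\<close> by (auto simp: is_basis_LV_def)
    then obtain J' where J': "J' \<subseteq> K" "finite J'" "J = h ` J'"
      using im by (metis finite_subset_image)
    have "tlincomb J' (c \<circ> h) (b \<circ> h) = tlincomb J c b"
      using J' inj_on_subset[OF inj J'(1)] by (simp add: tlincomb_def sum.reindex)
    then show ?thesis using J J' by (intro exI[of _ J'] exI[of _ "c \<circ> h"]) simp
  qed
  moreover have "\<exists>l\<in>Lgen p. nichols_zero p (tdiff ((b \<circ> h) i) l)" if "i \<in> K" for i
    using assms(1) im that by (auto simp: is_basis_LV_def)
  ultimately show ?thesis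
    unfolding is_basis_LV_def by (intro conjI ballI allI impI) auto
qed

lemma LV_dim_eq_card:
  assumes "is_basis_LV p I b" "finite I"
  shows "LV_dim_eq p (card I)"
proof -
  obtain h where "bij_betw h {0..<card I} I" using ex_bij_betw_nat_finite[OF assms(2)] by blast
  then have "is_basis_LV p {..<card I} (b \<circ> h)"
    by (intro is_basis_LV_reindex[OF assms(1)]) (simp add: atLeast0LessThan)
  then show ?thesis by (auto simp: LV_dim_eq_def)
qed

text \<open>Since \<open>m\<close> is positive, the removed index (0, m - 1) does lie in the
  product, so exactly one element is lost in the exceptional case.\<close>

lemma card_P2idx:
  assumes "mord (p 1 2 * p 2 1) = enat m" "m > 0"
  shows "finite (P2idx p)" "card (P2idx p) = (if exceptional p then 3 * m - 1 else 3 * m)"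
proof -
  have "{(t::nat, k). t < 3 \<and> enat k < enat m} = {..<3} \<times> {..<m}" by auto
  then have "P2idx p = {..<3} \<times> {..<m} - (if exceptional p then {(0, m - 1)} else {})"
    using assms(1) by (simp add: P2idx_def)
  then show "finite (P2idx p)" "card (P2idx p) = (if exceptional p then 3 * m - 1 else 3 * m)"
    using assms(2) by (simp_all add: card_cartesian_product)
qed

theorem theorem4p5:
  fixes p :: "nat \<Rightarrow> nat \<Rightarrow> 'a::field_char_0"
  assumes "p 1 1 = -1" and "p 2 2 = -1"
    and "p 1 2 \<noteq> 0" and "p 2 1 \<noteq> 0"
    and "p 1 2 * p 2 1 \<noteq> 1"
  shows "is_basis_LV p (P2idx p) (P2fam p)
    \<and> (\<forall>m. mord (p 1 2 * p 2 1) = enat m \<longrightarrow>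
          (exceptional p \<longrightarrow> LV_dim_eq p (3 * m - 1)) \<and>
          (\<not> exceptional p \<longrightarrow> LV_dim_eq p (3 * m)))"
proof -
  interpret super_plane p by unfold_locales (use assms in auto)
  have "LV_dim_eq p (if exceptional p then 3 * m - 1 else 3 * m)" if "mord (p 1 2 * p 2 1) = enat m" for m
  proof -
    \<comment> \<open>\<open>qpoch 0\<close> is the empty product 1, so 0 lies below the
      order.\<close>
    have "m > 0" using that qpoch_nonzero_iff[of 0] by (simp add: qpoch_def q_def zero_enat_def)
    then show ?thesis
      using LV_dim_eq_card[OF is_basis_P2fam] card_P2idx[OF that] by simp
  qed
  then show ?thesis using is_basis_P2fam by auto
qed

end
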